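(* Let $x_1,x_2,\dots$ be independent identically distributed random variables in $[0,1]$ with common probability density $f$ such that $f(x)$ is asymptotic to $c x^{\beta}$ as $x\to0^+$ (that is, $f(x)/(c x^{\beta})\to1$), where $c>0$ and $\beta>-1$. Let $X_n=\frac1n\sum_{i=1}^n\frac1{x_i}$. 1. If $\beta=0$, let $Y_n=X_n-c\log n$. Then the variables $Y_n$ converge in distribution to the unbalanced stable law $G$ with exponent $\alpha=1$. 2. If $\beta>0$, then $X_n$ converges in distribution to $\delta(x-\mathcal E)$, the point mass at $\mathcal E=\mathbf E(1/x_1)$. 3. If $-1<\beta<0$, then $n^{1-1/(1+\beta)}X_n$ converges in distribution to a stable law with exponent $\alpha=1+\beta$.
   Context: A nondegenerate distribution $G$ is a stable law of exponent $\alpha\in(0,2]$ if it is the limit in distribution of $n^{-1/\alpha}S_n-b_n$ for some real constants $b_n$ and some partial sums $S_n$ of i.i.d. random variables. For $0<\alpha<2$ its tails satisfy $x^{\alpha}(1-G(x))\to Cp$ and $x^{\alpha}G(-x)\to Cq$ as $x\to\infty$, with $C>0$, $p,q\ge0$, $p+q=1$; the law is called unbalanced if $p=1$ or $q=1$. For the uniform distribution on $[0,1]$ one has $\beta=0$, $c=1$.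
   Formalization: Part 1 as written fails, e.g. for f(x)=c+1/log(1/x) near 0. It is proved when the integral of (f(x)-c)/x over [e,1] has a finite limit as e→0+ (also necessary); for every f with β=0, convergence is proved after subtracting c log n + r_n for some r_n=o(log n). *)

theory Defs
  imports "HOL-Probability.Probability" "HOL-Library.Landau_Symbols"
begin

definition iid :: "'a measure \<Rightarrow> (nat \<Rightarrow> 'a \<Rightarrow> real) \<Rightarrow> bool" where
  "iid M X \<longleftrightarrow> prob_space M \<and> prob_space.indep_vars M (\<lambda>_. borel) X UNIV \<and>
     (\<forall>i. distr M borel (X i) = distr M borel (X 0))"

text \<open>
  Any iid sequence of real random variables can be realised on the space of real sequences, so
  fixing the sample type in the following definition loses no generality.
\<close>

definition stable_law :: "real \<Rightarrow> real measure \<Rightarrow> bool" where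
  "stable_law \<alpha> G \<longleftrightarrow> 0 < \<alpha> \<and> \<alpha> \<le> 2 \<and> real_distribution G \<and> (\<forall>a. G \<noteq> return borel a) \<and>
     (\<exists>(M :: (nat \<Rightarrow> real) measure) X b. iid M X \<and>
        weak_conv_m
          (\<lambda>n. distr M borel (\<lambda>\<omega>. real n powr (- 1 / \<alpha>) * (\<Sum>i<n. X i \<omega>) - b n)) G)"

definition unbalanced_stable_law :: "real \<Rightarrow> real measure \<Rightarrow> bool" where
  "unbalanced_stable_law \<alpha> G \<longleftrightarrow> stable_law \<alpha> G \<and> \<alpha> < 2 \<and>
     (\<exists>C p q. 0 < C \<and> 0 \<le> p \<and> 0 \<le> q \<and> p + q = 1 \<and>
        ((\<lambda>t. t powr \<alpha> * (1 - cdf G t)) \<longlongrightarrow> C * p) at_top \<and>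
        ((\<lambda>t. t powr \<alpha> * cdf G (- t)) \<longlongrightarrow> C * q) at_top \<and>
        (p = 1 \<or> q = 1))"

definition mean_recip :: "(nat \<Rightarrow> 'a \<Rightarrow> real) \<Rightarrow> nat \<Rightarrow> 'a \<Rightarrow> real" where
  "mean_recip x n \<omega> = 1 / real n * (\<Sum>i<n. 1 / x i \<omega>)"

text \<open>
  Convergence of the improper integral of \<open>(f t - c) / t\<close> at \<open>0\<close>.  It holds for the uniform
  density and whenever \<open>f t - c\<close> is \<open>O(t powr \<epsilon>)\<close> at \<open>0\<close> for some positive \<open>\<epsilon>\<close>.  For \<open>\<beta> = 0\<close> the
  proper centering of the mean of the reciprocals is the integral of \<open>f t / t\<close> over
  \<open>[1 / n, 1]\<close>.  This is always \<open>c * ln n + o(ln n)\<close>, and it is \<open>c * ln n\<close> plus a convergent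
  sequence precisely when the improper integral converges; \<open>f t \<sim> c\<close> alone is not enough, as
  densities equal to \<open>c + 1 / ln (1 / t)\<close> near \<open>0\<close> show (the centering is then
  \<open>c * ln n + ln (ln n) + O(1)\<close>).
\<close>

definition log_centering_condition :: "(real \<Rightarrow> real) \<Rightarrow> real \<Rightarrow> bool" where
  "log_centering_condition f c \<longleftrightarrow>
     (\<exists>L. ((\<lambda>e. LINT t:{e..1}|lborel. (f t - c) / t) \<longlongrightarrow> L) (at_right 0))"

end

theory Submission
  imports Defs "HOL-Real_Asymp.Real_Asymp"
begin

text \<open>
  Write \<open>a\<close> for \<open>n powr (1 / (1 + \<beta>))\<close>.  Substituting \<open>x = u / a\<close>, the measure \<open>n * f x dx\<close>
  becomes asymptotically \<open>c * u powr \<beta> du\<close>, so \<open>n * E (h (a * x 0))\<close> converges to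
  \<open>c * \<integral> u powr \<beta> * h u du\<close> for every bounded \<open>h\<close> decaying faster than \<open>u powr - (1 + \<beta>)\<close>.
  With \<open>h u = exp (i t / u) - 1\<close>, minus the compensator \<open>i t / u\<close> on \<open>u \<ge> 1\<close> if \<open>\<beta> = 0\<close>, this gives
  the limit of the characteristic functions of the normalised sums.  Pointwise convergence to a
  function continuous at \<open>0\<close> already yields a limit law.  For \<open>\<beta> = 0\<close> the same scaling limit,
  applied to truncated moments, shows that a large value of the normalised sum comes from a single
  large summand, whence the one-sided tails of the limit law.  For \<open>\<beta> > 0\<close> the reciprocals are
  integrable and the weak law of large numbers applies.
\<close>

section \<open>Limit laws from characteristic functions\<close>

text \<open>Membership in \<open>stable_law\<close> asks for a nondegenerate limit of normalised iid
  sums, so once a limit law exists the reciprocals themselves are its witness. What remains is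
  nondegeneracy and, for \<beta> = 0, the tails. The decay exponent \<open>k\<close> must exceed 1 +
  \<beta>. For \<beta> < 0 the estimate exp (i t / u) - 1 = O(1 / u) suffices with k = 1. At \<beta>
  = 0 this is exactly borderline: the reciprocals have logarithmically divergent truncated means.
  The compensator cancels the first-order term and raises the decay to k = 2, and its mean is the
  exact centering, \<open>center n\<close>. How far this is from c ln n depends on finer behaviour
  of the density than f ~ c, which is why the logarithmic case has two conclusions. Tails are hard
  to recover from a characteristic function. They are therefore obtained before the limit, by union
  and Chebyshev bounds at finite n, and transferred to the distribution function of the limit law. A
  truncation level proportional to t keeps the Chebyshev error of order 1 / t, with a constant that
  can be made as small as desired.\<close>

lemma power_tendsto_exp_of_centered:
  fixes z :: "nat \<Rightarrow> complex" and w :: "nat \<Rightarrow> real"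
  assumes z: "\<And>n. cmod (z n) \<le> 1"
    and lim: "(\<lambda>n. of_nat n * (z n - 1) - \<i> * w n) \<longlonglongrightarrow> \<psi>"
    and w: "(\<lambda>n. (w n)\<^sup>2 / n) \<longlonglongrightarrow> 0"
  shows "(\<lambda>n. z n ^ n * exp (- \<i> * w n)) \<longlonglongrightarrow> exp \<psi>"
proof -
  define D where "D n = of_nat n * (z n - 1) - \<i> * w n" for n
  have "(\<lambda>n. (cmod (D n))\<^sup>2 / n) \<longlonglongrightarrow> 0"
    by (rule real_tendsto_divide_at_top[OF _ filterlim_real_sequentially, of _ "(cmod \<psi>)\<^sup>2"])
      (use lim in \<open>auto simp: D_def intro!: tendsto_intros\<close>)
  from tendsto_mult_left[OF tendsto_add[OF this w], of 2]
  have "(\<lambda>n. 2 * ((cmod (D n))\<^sup>2 / n + (w n)\<^sup>2 / n)) \<longlonglongrightarrow> 0" by simp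
  \<comment> \<open>Here n (z - 1) = D + i w with D convergent, so its squared modulus divided by n
    is controlled by the two null sequences above.\<close>
  moreover have "real n * (cmod (z n - 1))\<^sup>2 \<le> 2 * ((cmod (D n))\<^sup>2 / n + (w n)\<^sup>2 / n)" for n
  proof (cases "n = 0")
    case False
    have "real n * cmod (z n - 1) = cmod (D n + \<i> * w n)"
      by (simp add: D_def norm_mult)
    also have "\<dots> \<le> cmod (D n) + \<bar>w n\<bar>"
      by (rule order_trans[OF norm_triangle_ineq]) (simp add: norm_mult)
    finally have "(real n * cmod (z n - 1))\<^sup>2 \<le> (cmod (D n) + \<bar>w n\<bar>)\<^sup>2"
      by (intro power_mono) auto
    also have "\<dots> \<le> 2 * ((cmod (D n))\<^sup>2 + (w n)\<^sup>2)"
      using sum_squares_bound[of "cmod (D n)" "\<bar>w n\<bar>"] by (simp add: power2_sum)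
    finally show ?thesis using False by (simp add: field_simps power2_eq_square)
  qed simp
  ultimately have sq: "(\<lambda>n. real n * (cmod (z n - 1))\<^sup>2) \<longlonglongrightarrow> 0"
    by (intro Lim_null_comparison[of "\<lambda>n. real n * (cmod (z n - 1))\<^sup>2" _ sequentially]) auto
  \<comment> \<open>Both \<open>z n\<close> and \<open>exp (z n - 1)\<close> lie in the closed unit
    disc, so their n-th powers differ by at most n times their distance, which is quadratic in z -
    1. The constant exp 2 comes from |Re (z - 1)| \<le> 2 in the Taylor remainder.\<close>
  have bound: "cmod (z n ^ n - exp (of_nat n * (z n - 1))) \<le> exp 2 * (real n * (cmod (z n - 1))\<^sup>2)" for n
  proof -
    have "Re (z n) \<le> 1" using complex_Re_le_cmod[of "z n"] z[of n] by linarith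
    then have "cmod (exp (z n - 1)) \<le> 1" by simp
    have "\<bar>Re (z n - 1)\<bar> \<le> cmod (z n - 1)" by (rule abs_Re_le_cmod)
    also have "\<dots> \<le> 2" using z[of n] norm_triangle_ineq4[of "z n" 1] by simp
    finally have "\<bar>Re (z n - 1)\<bar> \<le> 2" .
    have "cmod (z n - exp (z n - 1)) = cmod (exp (z n - 1) - (\<Sum>k\<le>1. (z n - 1) ^ k / fact k))"
      by (simp add: norm_minus_commute)
    also have "\<dots> \<le> exp \<bar>Re (z n - 1)\<bar> * (cmod (z n - 1))\<^sup>2"
      using Taylor_exp[of "z n - 1" 1] by (simp add: power2_eq_square)
    also have "\<dots> \<le> exp 2 * (cmod (z n - 1))\<^sup>2"
      using \<open>\<bar>Re (z n - 1)\<bar> \<le> 2\<close> by (intro mult_right_mono) auto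
    finally have "cmod (z n - exp (z n - 1)) \<le> exp 2 * (cmod (z n - 1))\<^sup>2" .
    moreover have "cmod (z n ^ n - exp (z n - 1) ^ n) \<le> n * cmod (z n - exp (z n - 1))"
      by (rule norm_power_diff) fact+
    moreover have "real n * cmod (z n - exp (z n - 1)) \<le> real n * (exp 2 * (cmod (z n - 1))\<^sup>2)"
      using \<open>cmod (z n - exp (z n - 1)) \<le> exp 2 * (cmod (z n - 1))\<^sup>2\<close> by (intro mult_left_mono) auto
    ultimately show ?thesis
      by (simp add: exp_of_nat_mult[symmetric] mult.commute mult.left_commute)
  qed
  have "(\<lambda>n. exp 2 * (real n * (cmod (z n - 1))\<^sup>2)) \<longlonglongrightarrow> 0"
    using tendsto_mult_left[OF sq, of "exp 2"] by simp
  then have "(\<lambda>n. z n ^ n - exp (of_nat n * (z n - 1))) \<longlonglongrightarrow> 0"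
    by (rule Lim_null_comparison[rotated]) (simp add: bound)
  \<comment> \<open>The extra factor has modulus 1 because \<open>w n\<close> is real.\<close>
  then have "(\<lambda>n. (z n ^ n - exp (of_nat n * (z n - 1))) * exp (- \<i> * w n)) \<longlonglongrightarrow> 0"
    by (rule Lim_null_comparison[rotated, OF tendsto_norm_zero]) (simp add: norm_mult)
  from tendsto_add[OF this tendsto_exp[OF lim]]
  have "(\<lambda>n. (z n ^ n - exp (of_nat n * (z n - 1))) * exp (- \<i> * w n) +
      exp (of_nat n * (z n - 1) - \<i> * w n)) \<longlonglongrightarrow> exp \<psi>" by simp
  moreover have "exp (of_nat n * (z n - 1) - \<i> * w n) = exp (of_nat n * (z n - 1)) * exp (- \<i> * w n)" for n
    by (subst mult_exp_exp) simp
  ultimately show ?thesis by (simp add: left_diff_distrib)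
qed

section \<open>Characteristic functions of sums of iid variables\<close>

lemma iidD:
  assumes "iid M X"
  shows "prob_space M" "prob_space.indep_vars M (\<lambda>_. borel) X UNIV"
    "X i \<in> borel_measurable M" "distr M borel (X i) = distr M borel (X 0)"
proof -
  show "prob_space M" "prob_space.indep_vars M (\<lambda>_. borel) X UNIV" "distr M borel (X i) = distr M borel (X 0)"
    using assms unfolding iid_def by blast+
  interpret prob_space M by fact
  show "X i \<in> borel_measurable M"
    using \<open>indep_vars (\<lambda>_. borel) X UNIV\<close> unfolding indep_vars_def2 by simp
qed

lemma (in prob_space) char_iid_affine_sum:
  assumes "iid M X"
  shows "char (distr M borel (\<lambda>\<omega>. a * (\<Sum>i<n. X i \<omega>) - b)) t =
    char (distr M borel (X 0)) (a * t) ^ n * exp (- \<i> * (t * b))"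
proof -
  note ind = iidD(2)[OF assms] and id = iidD(4)[OF assms] and [measurable] = iidD(3)[OF assms]
  have split: "iexp (t * (a * S - b)) = iexp ((a * t) * S) * exp (- \<i> * (t * b))" for S :: real
    by (subst mult_exp_exp, rule arg_cong[of _ _ exp]) (simp add: algebra_simps)
  have "char (distr M borel (\<lambda>\<omega>. a * (\<Sum>i<n. X i \<omega>) - b)) t =
      (CLINT \<omega>|M. iexp ((a * t) * (\<Sum>i<n. X i \<omega>)) * exp (- \<i> * (t * b)))"
    unfolding char_def split[symmetric] by (subst integral_distr) auto
  also have "\<dots> = (CLINT \<omega>|M. iexp ((a * t) * (\<Sum>i<n. X i \<omega>))) * exp (- \<i> * (t * b))"
    by (rule integral_mult_left_zero)
  also have "(CLINT \<omega>|M. iexp ((a * t) * (\<Sum>i<n. X i \<omega>))) =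
      char (distr M borel (\<lambda>\<omega>. \<Sum>i<n. X i \<omega>)) (a * t)"
    unfolding char_def by (subst integral_distr) auto
  also have "\<dots> = (\<Prod>i<n. char (distr M borel (X i)) (a * t))"
    by (rule char_distr_sum) (rule indep_vars_subset[OF ind], simp)
  also have "\<dots> = char (distr M borel (X 0)) (a * t) ^ n"
  proof -
    have "char (distr M borel (X i)) = char (distr M borel (X 0))" for i
      by (rule arg_cong[OF id])
    then have "(\<Prod>i<n. char (distr M borel (X i)) (a * t)) = (\<Prod>i<n. char (distr M borel (X 0)) (a * t))"
      by (rule prod.cong[OF refl fun_cong])
    then show ?thesis by (simp only: prod_constant card_lessThan)
  qed
  finally show ?thesis .
qed

section \<open>Existence of a limit law from convergent characteristic functions\<close>

text \<open>By Fubini, averaging \<open>char \<mu>\<close> over a Gaussian of standard deviation \<open>s\<close> integrates a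
  Gaussian bump against \<open>\<mu>\<close>; for small \<open>s\<close> this controls the tails of \<open>\<mu>\<close>.\<close>

lemma (in real_distribution) gaussian_average_char:
  "(CLINT z|std_normal_distribution. char M (s * z)) =
     of_real (LINT x|M. exp (- (s * x)\<^sup>2 / 2))"
proof -
  interpret N: real_distribution std_normal_distribution by (rule real_dist_normal_dist)
  interpret P: pair_sigma_finite std_normal_distribution M ..
  interpret Q: pair_prob_space std_normal_distribution M ..
  have "(CLINT z|std_normal_distribution. char M (s * z)) =
      (CLINT z|std_normal_distribution. (CLINT x|M. iexp (s * z * x)))"
    by (simp add: char_def)
  also have "\<dots> = (CLINT x|M. (CLINT z|std_normal_distribution. iexp (s * z * x)))"
    by (intro P.Fubini_integral[symmetric] Q.integrable_const_bound[of _ 1]) (auto simp: case_prod_beta)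
  also have "\<dots> = (CLINT x|M. char std_normal_distribution (s * x))"
    by (simp add: char_def mult_ac)
  also have "\<dots> = of_real (LINT x|M. exp (- (s * x)\<^sup>2 / 2))"
    by (simp add: char_std_normal_distribution del: of_real_exp)
  finally show ?thesis .
qed

lemma gaussian_average_tendsto:
  fixes \<phi> :: "nat \<Rightarrow> real \<Rightarrow> complex"
  assumes "\<And>n. \<phi> n \<in> borel_measurable borel" "\<theta> \<in> borel_measurable borel"
    and "\<And>n t. cmod (\<phi> n t) \<le> 1" and "\<And>t. (\<lambda>n. \<phi> n t) \<longlonglongrightarrow> \<theta> t"
  shows "(\<lambda>n. CLINT z|std_normal_distribution. \<phi> n z) \<longlonglongrightarrow> (CLINT z|std_normal_distribution. \<theta> z)"
proof -
  interpret N: real_distribution std_normal_distribution by (rule real_dist_normal_dist)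
  show ?thesis
    using assms by (intro integral_dominated_convergence[where w = "\<lambda>_. 1"]) auto
qed

text \<open>A Markov-type bound: where |x| \<ge> 2 / s the Gaussian factor is at most exp (-2) \<le>
  1 / 2, so the nonnegative integrand 2 (1 - exp (- (s x)^2 / 2)) is at least 1 there.\<close>

lemma (in real_distribution) tail_le_gaussian_average:
  assumes "0 < s"
  shows "measure M {x. 2 / s \<le> \<bar>x\<bar>} \<le> 2 * (1 - (LINT x|M. exp (- (s * x)\<^sup>2 / 2)))"
proof -
  have e2: "exp (- 2 :: real) \<le> 1 / 2"
    using exp_ge_add_one_self[of 2] by (simp add: exp_minus field_simps)
  have int: "integrable M (\<lambda>x. exp (- (s * x)\<^sup>2 / 2))"
    by (rule integrable_const_bound[of _ 1]) auto
  have "measure M {x. 2 / s \<le> \<bar>x\<bar>} = (LINT x|M. indicator {x. 2 / s \<le> \<bar>x\<bar>} x)"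
    by simp
  also have "\<dots> \<le> (LINT x|M. 2 * (1 - exp (- (s * x)\<^sup>2 / 2)))"
  proof (rule integral_mono)
    fix x
    show "indicator {x. 2 / s \<le> \<bar>x\<bar>} x \<le> 2 * (1 - exp (- (s * x)\<^sup>2 / 2))"
    proof (cases "2 / s \<le> \<bar>x\<bar>")
      case True
      then have "2 \<le> \<bar>s * x\<bar>" using assms by (simp add: field_simps abs_mult)
      then have "2\<^sup>2 \<le> (s * x)\<^sup>2" by (metis abs_le_square_iff abs_numeral)
      then have "exp (- (s * x)\<^sup>2 / 2) \<le> exp (- 2)" by simp
      with e2 have "2 * exp (- (s * x)\<^sup>2 / 2) \<le> 1" by linarith
      then show ?thesis using True by simp
    qed simp
  qed (use int in \<open>auto intro!: integrable_real_indicator simp: emeasure_eq_measure\<close>)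
  also have "\<dots> = 2 * (1 - (LINT x|M. exp (- (s * x)\<^sup>2 / 2)))"
    using int prob_space by (simp add: Bochner_Integration.integral_diff)
  finally show ?thesis .
qed

text \<open>Limits in n control all but finitely many measures. Each exceptional one is tight by
  itself, and the largest of the finitely many radii serves all of them.\<close>

lemma tight_of_eventually:
  assumes rd: "\<And>n. real_distribution (\<mu> n)"
    and ev: "\<And>\<epsilon>. 0 < \<epsilon> \<Longrightarrow> \<exists>K. \<forall>\<^sub>F n in sequentially. measure (\<mu> n) {x. K \<le> \<bar>x\<bar>} < \<epsilon>"
  shows "tight \<mu>"
  unfolding tight_def
proof (intro conjI allI impI rd)
  fix \<epsilon> :: real assume \<epsilon>: "0 < \<epsilon>"
  interpret real_distribution "\<mu> n" for n by (rule rd)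
  have out: "measure (\<mu> n) {-K<..K} > 1 - \<epsilon>" if "measure (\<mu> n) {x. K \<le> \<bar>x\<bar>} < \<epsilon>" for n K
  proof -
    have "1 - measure (\<mu> n) {x. K \<le> \<bar>x\<bar>} = measure (\<mu> n) (UNIV - {x. K \<le> \<bar>x\<bar>})"
      by (subst prob_compl[of "{x. K \<le> \<bar>x\<bar>}" n, simplified]) auto
    also have "\<dots> \<le> measure (\<mu> n) {-K<..K}"
      by (intro finite_measure_mono) auto
    finally show ?thesis using that by simp
  qed
  have mono: "measure (\<mu> n) {x. K' \<le> \<bar>x\<bar>} \<le> measure (\<mu> n) {x. K \<le> \<bar>x\<bar>}" if "K \<le> K'" for n K K'
    using that by (intro finite_measure_mono) auto
  have each: "\<exists>K. measure (\<mu> n) {x. K \<le> \<bar>x\<bar>} < \<epsilon>" for n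
  proof -
    have "(\<lambda>k. measure (\<mu> n) {x. real k \<le> \<bar>x\<bar>}) \<longlonglongrightarrow> measure (\<mu> n) (\<Inter>k. {x. real k \<le> \<bar>x\<bar>})"
      by (rule finite_Lim_measure_decseq) (auto simp: decseq_def)
    also have "(\<Inter>k. {x :: real. real k \<le> \<bar>x\<bar>}) = {}"
    proof (intro equals0I)
      fix x :: real assume "x \<in> (\<Inter>k. {x. real k \<le> \<bar>x\<bar>})"
      moreover obtain k where "\<bar>x\<bar> < real k" using reals_Archimedean2 by blast
      ultimately show False by (auto simp: not_less[symmetric])
    qed
    finally have "\<forall>\<^sub>F k in sequentially. measure (\<mu> n) {x. real k \<le> \<bar>x\<bar>} < \<epsilon>"
      using \<epsilon> by (intro order_tendstoD(2)[where y = 0]) auto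
    then show ?thesis by (auto simp: eventually_sequentially)
  qed
  then obtain k where k: "measure (\<mu> n) {x. k n \<le> \<bar>x\<bar>} < \<epsilon>" for n by metis
  from ev[OF \<epsilon>] obtain K N where KN: "\<And>n. N \<le> n \<Longrightarrow> measure (\<mu> n) {x. K \<le> \<bar>x\<bar>} < \<epsilon>"
    by (auto simp: eventually_sequentially)
  \<comment> \<open>Inserting 1 keeps the radius positive, so that the interval from -L to L is
    nonempty.\<close>
  define L where "L = Max (insert 1 (insert K (k ` {..<N})))"
  have L: "1 \<le> L" "K \<le> L" "\<And>n. n < N \<Longrightarrow> k n \<le> L"
    unfolding L_def by (intro Max_ge; simp)+
  have "measure (\<mu> n) {x. L \<le> \<bar>x\<bar>} < \<epsilon>" for n
    using KN[of n] k[of n] mono[OF L(2), of n] mono[OF L(3), of n n] by (cases "n < N") auto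
  then show "\<exists>a b. a < b \<and> (\<forall>n. 1 - \<epsilon> < measure (\<mu> n) {a<..b})"
    using out L(1) by (intro exI[of _ "-L"] exI[of _ L]) auto
qed

text \<open>Continuity at 0 is what gives tightness: averages of \<theta> over narrow Gaussians are
  close to \<theta> 0 = 1, and they bound the tails of \<mu> n for large n. A convergent subsequence
  then yields a law with characteristic function \<theta>, after which the version of the continuity
  theorem with a known limit applies to the whole sequence.\<close>

theorem levy_continuity_exists:
  assumes rd: "\<And>n. real_distribution (\<mu> n)"
    and lim: "\<And>t. (\<lambda>n. char (\<mu> n) t) \<longlonglongrightarrow> \<theta> t"
    and cont: "isCont \<theta> 0"
  shows "\<exists>G. real_distribution G \<and> char G = \<theta> \<and> weak_conv_m \<mu> G"
proof -
  interpret real_distribution "\<mu> n" for n by (rule rd)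
  interpret N: real_distribution std_normal_distribution by (rule real_dist_normal_dist)
  have [measurable]: "\<theta> \<in> borel_measurable borel"
    by (rule borel_measurable_LIMSEQ_metric[OF _ lim]) simp
  have bound: "cmod (\<theta> t) \<le> 1" for t
    by (rule tendsto_upperbound[OF tendsto_norm[OF lim]]) (auto simp: cmod_char_le_1)
  have "\<theta> 0 = 1" using LIMSEQ_unique[OF lim[of 0]] by (simp add: char_zero)
  have "(\<lambda>k. CLINT z|std_normal_distribution. \<theta> (1 / Suc k * z)) \<longlonglongrightarrow> (CLINT z|std_normal_distribution. 1)"
  proof (rule gaussian_average_tendsto)
    fix t :: real
    have "(\<lambda>k. 1 / Suc k * t) \<longlonglongrightarrow> 0 * t"
      by (intro tendsto_intros LIMSEQ_inverse_real_of_nat[unfolded inverse_eq_divide])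
    then show "(\<lambda>k. \<theta> (1 / Suc k * t)) \<longlonglongrightarrow> 1"
      using isCont_tendsto_compose[OF cont, of "\<lambda>k. 1 / Suc k * t"] \<open>\<theta> 0 = 1\<close> by simp
  qed (auto simp: bound)
  then have lim_s: "(\<lambda>k. Re (CLINT z|std_normal_distribution. \<theta> (1 / Suc k * z))) \<longlonglongrightarrow> 1"
    using N.prob_space tendsto_Re by fastforce
  have tight: "tight \<mu>"
  proof (rule tight_of_eventually[OF rd])
    fix \<epsilon> :: real assume \<epsilon>: "0 < \<epsilon>"
    \<comment> \<open>The width s is fixed before n tends to infinity. The defect \<epsilon> / 2
      compensates the factor 2 in \<open>tail_le_gaussian_average\<close>.\<close>
    from order_tendstoD(1)[OF lim_s, of "1 - \<epsilon> / 2"] \<epsilon>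
    obtain k where k: "1 - \<epsilon> / 2 < Re (CLINT z|std_normal_distribution. \<theta> (1 / Suc k * z))"
      by (auto simp: eventually_sequentially)
    define s :: real where "s = 1 / Suc k"
    have s: "0 < s" "1 - \<epsilon> / 2 < Re (CLINT z|std_normal_distribution. \<theta> (s * z))"
      using k by (auto simp: s_def)
    have "(\<lambda>n. CLINT z|std_normal_distribution. char (\<mu> n) (s * z)) \<longlonglongrightarrow>
        (CLINT z|std_normal_distribution. \<theta> (s * z))"
      by (rule gaussian_average_tendsto) (auto intro: lim simp: cmod_char_le_1)
    then have "(\<lambda>n. LINT x|\<mu> n. exp (- (s * x)\<^sup>2 / 2)) \<longlonglongrightarrow>
        Re (CLINT z|std_normal_distribution. \<theta> (s * z))"
      unfolding gaussian_average_char by (drule_tac tendsto_Re) simp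
    from order_tendstoD(1)[OF this s(2)]
    have "\<forall>\<^sub>F n in sequentially. measure (\<mu> n) {x. 2 / s \<le> \<bar>x\<bar>} < \<epsilon>"
    proof eventually_elim
      case (elim n)
      then show ?case using tail_le_gaussian_average[OF s(1), of n] by simp
    qed
    then show "\<exists>K. \<forall>\<^sub>F n in sequentially. measure (\<mu> n) {x. K \<le> \<bar>x\<bar>} < \<epsilon>" by blast
  qed
  have char_sub: "char \<nu> = \<theta>"
    if s: "strict_mono s" and \<nu>: "real_distribution \<nu>" "weak_conv_m (\<mu> \<circ> s) \<nu>" for s \<nu>
  proof
    fix t
    have "(\<lambda>n. char ((\<mu> \<circ> s) n) t) \<longlonglongrightarrow> char \<nu> t"
      by (rule levy_continuity1[OF _ \<nu>]) (simp add: rd)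
    moreover have "(\<lambda>n. char ((\<mu> \<circ> s) n) t) \<longlonglongrightarrow> \<theta> t"
      using LIMSEQ_subseq_LIMSEQ[OF lim s] by (simp add: comp_def)
    ultimately show "char \<nu> t = \<theta> t" by (rule LIMSEQ_unique)
  qed
  obtain r G where r: "strict_mono r" and G: "real_distribution G" "weak_conv_m (\<mu> \<circ> id \<circ> r) G"
    using tight_imp_convergent_subsubsequence[OF tight strict_mono_id] by blast
  have charG: "char G = \<theta>" using char_sub[OF r G(1)] G(2) by simp
  \<comment> \<open>Now \<theta> is known to be a characteristic function, so no subsequence
    remains.\<close>
  moreover have "weak_conv_m \<mu> G"
    by (rule levy_continuity) (auto simp: rd G charG lim)
  ultimately show ?thesis using G(1) by blast
qed

section \<open>Transport of iid sequences\<close>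

lemma iid_compose:
  assumes "iid M X" "g \<in> borel_measurable borel"
  shows "iid M (\<lambda>i \<omega>. g (X i \<omega>))"
proof -
  interpret prob_space M by (rule iidD(1)[OF assms(1)])
  note [measurable] = assms(2)
  note ind = iidD(2)[OF assms(1)] and id = iidD(4)[OF assms(1)] and [measurable] = iidD(3)[OF assms(1)]
  have "distr M borel (\<lambda>\<omega>. g (X i \<omega>)) = distr (distr M borel (X i)) borel g" for i
    by (simp add: distr_distr comp_def)
  then have "distr M borel (\<lambda>\<omega>. g (X i \<omega>)) = distr M borel (\<lambda>\<omega>. g (X 0 \<omega>))" for i
    using id by metis
  moreover have "indep_vars (\<lambda>_. borel) (\<lambda>i \<omega>. g (X i \<omega>)) UNIV"
    by (rule indep_vars_compose2[OF ind]) simp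
  ultimately show ?thesis
    using prob_space_axioms unfolding iid_def by blast
qed

text \<open>The sample type in \<open>stable_law\<close> is fixed to real sequences. The joint law
  of the sequence, with the coordinates as variables, carries every given iid sequence there without
  changing the law of any affine function of a partial sum.\<close>

lemma iid_realisation:
  assumes "iid M X"
  shows "\<exists>(M' :: (nat \<Rightarrow> real) measure) X'. iid M' X' \<and>
    (\<forall>n a b. distr M' borel (\<lambda>\<omega>. a * (\<Sum>i<n. X' i \<omega>) - b) =
             distr M borel (\<lambda>\<omega>. a * (\<Sum>i<n. X i \<omega>) - b))"
proof -
  interpret prob_space M by (rule iidD(1)[OF assms])
  note ind = iidD(2)[OF assms] and id = iidD(4)[OF assms] and [measurable] = iidD(3)[OF assms]
  define M' where "M' = distr M (PiM UNIV (\<lambda>_ :: nat. borel :: real measure)) (\<lambda>\<omega> i. X i \<omega>)"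
  have meas[measurable]: "(\<lambda>\<omega> i. X i \<omega>) \<in> measurable M (PiM UNIV (\<lambda>_ :: nat. borel :: real measure))"
    by (rule measurable_PiM_single') auto
  interpret M': prob_space M' unfolding M'_def by (rule prob_space_distr) simp
  have [measurable]: "(\<lambda>\<omega>. \<omega> i) \<in> borel_measurable M'" for i
    unfolding M'_def by simp
  have coord: "distr M' borel (\<lambda>\<omega>. \<omega> i) = distr M borel (X i)" for i
    unfolding M'_def by (subst distr_distr) (auto simp: comp_def)
  have sets': "sets M' = sets (PiM UNIV (\<lambda>_ :: nat. borel :: real measure))"
    by (simp add: M'_def)
  \<comment> \<open>Independence is equivalent to the joint law being the product of the marginals;
    the joint law of the coordinates under \<open>M'\<close> is \<open>M'\<close> itself.\<close>
  have "distr M' (PiM UNIV (\<lambda>_. borel)) (\<lambda>\<omega>. \<lambda>i\<in>UNIV. \<omega> i) = M'"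
    unfolding restrict_UNIV by (rule distr_id2[OF sets'[symmetric]])
  also have "M' = (\<Pi>\<^sub>M i\<in>UNIV. distr M borel (X i))"
    using indep_vars_iff_distr_eq_PiM[where I = UNIV and M' = "\<lambda>_. borel" and X = X] ind
    by (simp add: M'_def restrict_UNIV)
  also have "\<dots> = (\<Pi>\<^sub>M i\<in>UNIV. distr M' borel (\<lambda>\<omega>. \<omega> i))"
    by (simp add: coord)
  finally have "M'.indep_vars (\<lambda>_. borel) (\<lambda>i \<omega>. \<omega> i) UNIV"
    by (subst M'.indep_vars_iff_distr_eq_PiM) auto
  then have "iid M' (\<lambda>i \<omega>. \<omega> i)"
    unfolding iid_def coord using id M'.prob_space_axioms by blast
  moreover have "distr M' borel (\<lambda>\<omega>. a * (\<Sum>i<n. \<omega> i) - b) =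
      distr M borel (\<lambda>\<omega>. a * (\<Sum>i<n. X i \<omega>) - b)" for n a b
    unfolding M'_def by (subst distr_distr) (auto simp: comp_def)
  ultimately show ?thesis by blast
qed

section \<open>Scaling limits of a density with power behaviour at the origin\<close>

text \<open>A bridge from gauge integrals, for which power functions have explicit antiderivatives,
  to Lebesgue integrability: nonnegativity makes the integral absolute, and Borel measurability
  removes the completion.\<close>

lemma set_integrable_lborel_of_nonneg:
  fixes g :: "real \<Rightarrow> real"
  assumes "g integrable_on S" "\<And>u. u \<in> S \<Longrightarrow> 0 \<le> g u" "S \<in> sets borel" "g \<in> borel_measurable borel"
  shows "set_integrable lborel S g"
proof -
  have "set_integrable lebesgue S g"
    by (rule nonnegative_absolutely_integrable_1) (use assms in auto)
  then show ?thesis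
    using assms unfolding set_integrable_def by (subst (asm) integrable_completion) auto
qed

text \<open>This is the dominating function of all later limits: a bounded \<open>h\<close> of decay
  k is at most a multiple of min 1 (u powr - k). Integrability at 0 uses -1 < \<beta>, integrability
  at infinity uses \<beta> - k < -1.\<close>

lemma set_integrable_powr_min:
  fixes \<beta> k :: real
  assumes "-1 < \<beta>" "1 + \<beta> < k"
  shows "set_integrable lborel {0<..} (\<lambda>u. u powr \<beta> * min 1 (u powr - k))"
proof -
  have 1: "set_integrable lborel {0..1} (\<lambda>u. u powr \<beta>)"
    by (rule set_integrable_lborel_of_nonneg) (use assms integrable_on_powr_from_0[of \<beta> 1] in auto)
  have 2: "set_integrable lborel {1..} (\<lambda>u. u powr (\<beta> - k))"
    by (rule set_integrable_lborel_of_nonneg) (use assms has_integral_powr_to_inf[of "\<beta> - k" 1] in \<open>auto simp: integrable_on_def\<close>)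
  show ?thesis
    unfolding set_integrable_def
  proof (rule Bochner_Integration.integrable_bound[OF Bochner_Integration.integrable_add[OF 1[unfolded set_integrable_def] 2[unfolded set_integrable_def]]])
    show "AE u in lborel. norm (indicat_real {0<..} u *\<^sub>R (u powr \<beta> * min 1 (u powr - k)))
       \<le> norm (indicat_real {0..1} u *\<^sub>R u powr \<beta> + indicat_real {1..} u *\<^sub>R u powr (\<beta> - k))"
    proof (rule AE_I2)
      fix u :: real
      have "u powr \<beta> * min 1 (u powr - k) \<le> u powr \<beta>"
        by (simp add: mult_left_le)
      moreover have "u powr \<beta> * min 1 (u powr - k) \<le> u powr \<beta> * u powr (- k)"
        by (intro mult_left_mono) auto
      ultimately show "norm (indicat_real {0<..} u *\<^sub>R (u powr \<beta> * min 1 (u powr - k)))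
       \<le> norm (indicat_real {0..1} u *\<^sub>R u powr \<beta> + indicat_real {1..} u *\<^sub>R u powr (\<beta> - k))"
        by (auto simp: indicator_def powr_add[symmetric] abs_mult)
    qed
  qed simp
qed

locale power_density =
  fixes f :: "real \<Rightarrow> real" and c \<beta> :: real
  assumes f_measurable[measurable]: "f \<in> borel_measurable borel"
    and f_nonneg: "\<And>t. 0 \<le> f t"
    and f_integrable: "integrable lborel f"
    and c_pos: "0 < c"
    and \<beta>: "-1 < \<beta>"
    and asymp: "((\<lambda>t. f t / (c * t powr \<beta>)) \<longlongrightarrow> 1) (at_right 0)"
begin

lemma near_zero_bound:
  obtains \<delta> where "0 < \<delta>" "\<And>x. 0 < x \<Longrightarrow> x < \<delta> \<Longrightarrow> f x \<le> 2 * c * x powr \<beta>"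
proof -
  have "\<forall>\<^sub>F x in at_right 0. f x / (c * x powr \<beta>) < 2"
    by (rule order_tendstoD(2)[OF asymp]) simp
  then obtain \<delta> where "0 < \<delta>" "\<And>x. 0 < x \<Longrightarrow> x < \<delta> \<Longrightarrow> f x / (c * x powr \<beta>) < 2"
    by (auto simp: eventually_at_right_field)
  moreover have "f x \<le> 2 * c * x powr \<beta>" if "0 < x" "f x / (c * x powr \<beta>) < 2" for x
    using that c_pos by (simp add: field_simps)
  ultimately show thesis using that by blast
qed

definition scale :: "nat \<Rightarrow> real" where
  "scale n = real n powr (1 / (1 + \<beta>))"

lemma scale_pos: "0 < n \<Longrightarrow> 0 < scale n"
  by (simp add: scale_def)

lemma scale_powr: "scale n powr (1 + \<beta>) = real n"
  using \<beta> by (simp add: scale_def powr_powr)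

lemma scale_at_top: "filterlim scale at_top sequentially"
  unfolding scale_def
  using \<beta> by real_asymp

text \<open>After the substitution \<open>x = u / scale n\<close> the density \<open>n * f (u / scale n) / scale n\<close> converges
  to \<open>c * u powr \<beta>\<close>.  The domination only works for small \<open>x\<close>; the rest of the integral is
  \<open>O(n powr (1 - k / (1 + \<beta>)))\<close>.\<close>

theorem scaling_limit:
  fixes h :: "real \<Rightarrow> 'b :: {banach, second_countable_topology}"
  assumes [measurable]: "h \<in> borel_measurable borel"
    and k: "1 + \<beta> < k"
    and h_le: "\<And>u. 0 < u \<Longrightarrow> norm (h u) \<le> A"
    and h_decay: "\<And>u. 0 < u \<Longrightarrow> norm (h u) \<le> A * u powr - k"
  shows "(\<lambda>n. real n *\<^sub>R (LINT x:{0<..}|lborel. f x *\<^sub>R h (scale n * x))) \<longlonglongrightarrow>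
    c *\<^sub>R (LINT u:{0<..}|lborel. u powr \<beta> *\<^sub>R h u)"
proof -
  obtain \<delta> where \<delta>: "0 < \<delta>" "\<And>x. 0 < x \<Longrightarrow> x < \<delta> \<Longrightarrow> f x \<le> 2 * c * x powr \<beta>"
    using near_zero_bound by blast
  have A: "0 \<le> A" using h_le[of 1] norm_ge_zero[of "h 1"] by linarith
  define g where "g n x = f x *\<^sub>R h (scale n * x)" for n x
  have [measurable]: "g n \<in> borel_measurable borel" for n
    unfolding g_def by simp
  have g_int: "set_integrable lborel S (g n)" if "S \<subseteq> {0<..}" "S \<in> sets borel" "0 < n" for S n
    unfolding set_integrable_def
  proof (rule Bochner_Integration.integrable_bound[OF integrable_mult_left[OF f_integrable, of A]])
    show "AE x in lborel. norm (indicat_real S x *\<^sub>R g n x) \<le> norm (f x * A)"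
      using that f_nonneg A h_le scale_pos[of n]
      by (intro AE_I2) (auto simp: g_def indicator_def intro!: mult_left_mono)
  qed (use that in simp)
  have split: "(LINT x:{0<..}|lborel. g n x) = (LINT x:{0<..<\<delta>}|lborel. g n x) + (LINT x:{\<delta>..}|lborel. g n x)"
    if "0 < n" for n
  proof -
    have "{0<..} = {0<..<\<delta>} \<union> {\<delta>..}" using \<delta>(1) by auto
    then show ?thesis
      using \<delta>(1) g_int that by (simp only:) (rule set_integral_Un; auto)
  qed
  have far_sub: "{\<delta>..} \<subseteq> {0<..}" using \<delta>(1) by auto
  \<comment> \<open>Away from 0 nothing is known about \<open>f\<close> except its integrability, so
    all the smallness has to come from the decay of \<open>h\<close>.\<close>
  have far: "(\<lambda>n. real n *\<^sub>R (LINT x:{\<delta>..}|lborel. g n x)) \<longlonglongrightarrow> 0"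
  proof (rule Lim_null_comparison)
    show "\<forall>\<^sub>F n in sequentially. norm (real n *\<^sub>R (LINT x:{\<delta>..}|lborel. g n x)) \<le>
        real n * (A * (scale n * \<delta>) powr - k * (LINT x|lborel. f x))"
    proof (rule eventually_sequentiallyI[of 1])
      fix n :: nat assume n: "1 \<le> n"
      have "norm (LINT x:{\<delta>..}|lborel. g n x) \<le> (LINT x|lborel. A * (scale n * \<delta>) powr - k * f x)"
        unfolding set_lebesgue_integral_def
      proof (rule order_trans[OF integral_norm_bound], rule integral_mono)
        show "integrable lborel (\<lambda>x. norm (indicat_real {\<delta>..} x *\<^sub>R g n x))"
          using g_int[OF far_sub, of n] n unfolding set_integrable_def by (intro integrable_norm) auto
        show "integrable lborel (\<lambda>x. A * (scale n * \<delta>) powr - k * f x)"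
          using f_integrable by simp
        fix x
        show "norm (indicat_real {\<delta>..} x *\<^sub>R g n x) \<le> A * (scale n * \<delta>) powr - k * f x"
        proof (cases "\<delta> \<le> x")
          case True
          have "norm (h (scale n * x)) \<le> A * (scale n * x) powr - k"
            using True \<delta>(1) n scale_pos[of n] by (intro h_decay) simp
          also have "\<dots> \<le> A * (scale n * \<delta>) powr - k"
            using True \<delta>(1) n scale_pos[of n] A k \<beta> by (intro mult_left_mono powr_mono2') auto
          finally have "f x * norm (h (scale n * x)) \<le> f x * (A * (scale n * \<delta>) powr - k)"
            using f_nonneg by (intro mult_left_mono)
          then show ?thesis using True f_nonneg by (simp add: g_def mult_ac)
        qed (use A f_nonneg in simp)
      qed
      then show "norm (real n *\<^sub>R (LINT x:{\<delta>..}|lborel. g n x)) \<le>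
        real n * (A * (scale n * \<delta>) powr - k * (LINT x|lborel. f x))"
        by (simp add: mult_left_mono)
    qed
    have "\<forall>\<^sub>F n in sequentially. A * \<delta> powr - k * (LINT x|lborel. f x) * real n powr (1 - k / (1 + \<beta>)) =
        real n * (A * (scale n * \<delta>) powr - k * (LINT x|lborel. f x))"
    proof (rule eventually_sequentiallyI[of 1])
      fix n :: nat assume n: "1 \<le> n"
      have "real n powr (1 - k / (1 + \<beta>)) = real n * scale n powr - k"
        using n by (simp add: scale_def powr_powr powr_diff powr_minus_divide)
      then show "A * \<delta> powr - k * (LINT x|lborel. f x) * real n powr (1 - k / (1 + \<beta>)) =
        real n * (A * (scale n * \<delta>) powr - k * (LINT x|lborel. f x))"
        using \<delta>(1) scale_pos[of n] n by (simp add: powr_mult)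
    qed
    moreover have "(\<lambda>n. A * \<delta> powr - k * (LINT x|lborel. f x) * real n powr (1 - k / (1 + \<beta>))) \<longlonglongrightarrow> 0"
    proof (intro tendsto_mult_right_zero)
      have "1 - k / (1 + \<beta>) < 0" using k \<beta> by (simp add: field_simps)
      then show "(\<lambda>n. real n powr (1 - k / (1 + \<beta>))) \<longlonglongrightarrow> 0"
        by (rule tendsto_neg_powr[OF _ filterlim_real_sequentially])
    qed
    ultimately show "(\<lambda>n. real n * (A * (scale n * \<delta>) powr - k * (LINT x|lborel. f x))) \<longlonglongrightarrow> 0"
      by (rule Lim_transform_eventually[rotated])
  qed
  \<comment> \<open>The rescaled density, cut off to x < \<delta>, where the majorant 2 c x powr
    \<beta> is available.\<close>
  define F where "F n u = indicator {0<..<\<delta>} (u / scale n) * (real n / scale n) * f (u / scale n)" for n u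
  have [measurable]: "F n \<in> borel_measurable borel" for n
    unfolding F_def by simp
  have subst: "real n *\<^sub>R (LINT x:{0<..<\<delta>}|lborel. g n x) = (LINT u|lborel. F n u *\<^sub>R h u)" if n: "0 < n" for n
  proof -
    have "(LINT x:{0<..<\<delta>}|lborel. g n x) =
        \<bar>1 / scale n\<bar> *\<^sub>R (LINT u|lborel. indicator {0<..<\<delta>} (0 + 1 / scale n * u) *\<^sub>R g n (0 + 1 / scale n * u))"
      unfolding set_lebesgue_integral_def
      using scale_pos[OF n] by (intro lborel_integral_real_affine) simp
    then have "real n *\<^sub>R (LINT x:{0<..<\<delta>}|lborel. g n x) =
       (LINT u|lborel. (real n * \<bar>1 / scale n\<bar>) *\<^sub>R (indicat_real {0<..<\<delta>} (0 + 1 / scale n * u) *\<^sub>R g n (0 + 1 / scale n * u)))"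
      unfolding integral_scaleR_right by (simp only: scaleR_scaleR)
    also have "\<dots> = (LINT u|lborel. F n u *\<^sub>R h u)"
      using scale_pos[OF n]
      by (intro Bochner_Integration.integral_cong) (auto simp: F_def g_def mult_ac)
    finally show ?thesis .
  qed
  \<comment> \<open>Exact invariance of the pure power under the rescaling, because n =
    \<open>scale n\<close> powr (1 + \<beta>). It turns the local bound on \<open>f\<close> into a
    majorant that does not depend on n.\<close>
  have dens: "real n / scale n * (u / scale n) powr \<beta> = u powr \<beta>" if "0 < n" "0 < u" for n u
  proof -
    have "(u / scale n) powr \<beta> = u powr \<beta> / scale n powr \<beta>"
      using that scale_pos[of n] by (simp add: powr_divide)
    moreover have "real n = scale n * scale n powr \<beta>"
      using that scale_powr[of n] scale_pos[of n] by (simp add: powr_add)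
    ultimately show ?thesis using scale_pos[of n] that(1) by (simp add: field_simps)
  qed
  have near: "(\<lambda>n. LINT u|lborel. F n u *\<^sub>R h u) \<longlonglongrightarrow> (LINT u|lborel. indicator {0<..} u *\<^sub>R (c * u powr \<beta>) *\<^sub>R h u)"
  proof (rule integral_dominated_convergence)
    show "integrable lborel (\<lambda>u. 2 * c * A * (indicator {0<..} u *\<^sub>R (u powr \<beta> * min 1 (u powr - k))))"
      using set_integrable_powr_min[OF \<beta> k] unfolding set_integrable_def by simp
    show "AE u in lborel. norm (F n u *\<^sub>R h u) \<le>
        2 * c * A * (indicator {0<..} u *\<^sub>R (u powr \<beta> * min 1 (u powr - k)))" for n
    proof (rule AE_I2)
      fix u :: real
      show "norm (F n u *\<^sub>R h u) \<le> 2 * c * A * (indicator {0<..} u *\<^sub>R (u powr \<beta> * min 1 (u powr - k)))"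
      proof (cases "0 < n \<and> u / scale n \<in> {0<..<\<delta>}")
        case True
        then have u: "0 < u" using scale_pos[of n] by (auto simp: zero_less_divide_iff)
        have "norm (F n u) = real n / scale n * f (u / scale n)"
          using True f_nonneg scale_pos[of n] by (simp add: F_def)
        also have "\<dots> \<le> real n / scale n * (2 * c * (u / scale n) powr \<beta>)"
          using True scale_pos[of n] by (intro mult_left_mono \<delta>) auto
        also have "\<dots> = 2 * c * (real n / scale n * (u / scale n) powr \<beta>)" by simp
        also have "\<dots> = 2 * c * u powr \<beta>" using True u dens[of n u] by simp
        finally have "norm (F n u) \<le> 2 * c * u powr \<beta>" .
        moreover have "norm (h u) \<le> A * min 1 (u powr - k)"
          using h_le[OF u] h_decay[OF u] by (auto simp: min_def)
        ultimately have "norm (F n u) * norm (h u) \<le> 2 * c * u powr \<beta> * (A * min 1 (u powr - k))"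
          using c_pos by (intro mult_mono) auto
        then show ?thesis using u by (simp add: mult_ac)
      next
        case False
        then have "F n u = 0" by (auto simp: F_def)
        then show ?thesis using c_pos A by (simp add: indicator_def)
      qed
    qed
    show "AE u in lborel. (\<lambda>n. F n u *\<^sub>R h u) \<longlonglongrightarrow> indicator {0<..} u *\<^sub>R (c * u powr \<beta>) *\<^sub>R h u"
    proof (rule AE_I2)
      fix u :: real
      have "(\<lambda>n. F n u) \<longlonglongrightarrow> indicator {0<..} u * (c * u powr \<beta>)"
      proof (cases "0 < u")
        case True
        have to0: "(\<lambda>n. u / scale n) \<longlonglongrightarrow> 0"
          by (rule real_tendsto_divide_at_top[OF tendsto_const scale_at_top])
        have pos: "\<forall>\<^sub>F n in sequentially. 0 < u / scale n"
          using True scale_pos by (intro eventually_sequentiallyI[of 1]) auto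
        have "filterlim (\<lambda>n. u / scale n) (at_right 0) sequentially"
          unfolding filterlim_at using to0 pos by (auto elim: eventually_mono)
        from filterlim_compose[OF asymp this]
        have "(\<lambda>n. f (u / scale n) / (c * (u / scale n) powr \<beta>) * (c * u powr \<beta>)) \<longlonglongrightarrow> 1 * (c * u powr \<beta>)"
          by (intro tendsto_intros)
        moreover have "\<forall>\<^sub>F n in sequentially. f (u / scale n) / (c * (u / scale n) powr \<beta>) * (c * u powr \<beta>) = F n u"
          using order_tendstoD(2)[OF to0 \<delta>(1)] pos eventually_gt_at_top[of 0]
        proof eventually_elim
          case (elim n)
          have "f (u / scale n) / (c * (u / scale n) powr \<beta>) * (c * u powr \<beta>) =
            f (u / scale n) / (c * (u / scale n) powr \<beta>) * (c * (real n / scale n * (u / scale n) powr \<beta>))"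
            using dens[OF elim(3) True] by simp
          also have "\<dots> = F n u"
            using elim c_pos True by (simp add: F_def field_simps)
          finally show ?case .
        qed
        ultimately show ?thesis
          using True by (auto dest: Lim_transform_eventually)
      next
        case False
        \<comment> \<open>For u \<le> 0 the rescaled point is never positive; for n = 0 it is u / 0
          = 0, which also lies outside the open interval.\<close>
        then have "F n u = 0" for n
          using scale_pos[of n] by (cases "n = 0") (auto simp: F_def indicator_def zero_less_divide_iff)
        then show ?thesis using False by simp
      qed
      then show "(\<lambda>n. F n u *\<^sub>R h u) \<longlonglongrightarrow> indicator {0<..} u *\<^sub>R (c * u powr \<beta>) *\<^sub>R h u"
        using tendsto_scaleR[OF _ tendsto_const[of "h u"]] by fastforce
    qed
  qed simp_all
  have "(LINT u|lborel. indicator {0<..} u *\<^sub>R (c * u powr \<beta>) *\<^sub>R h u) =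
      (LINT u|lborel. c *\<^sub>R (indicat_real {0<..} u *\<^sub>R u powr \<beta> *\<^sub>R h u))"
    by (intro Bochner_Integration.integral_cong) (auto simp: mult_ac)
  also have "\<dots> = c *\<^sub>R (LINT u:{0<..}|lborel. u powr \<beta> *\<^sub>R h u)"
    unfolding set_lebesgue_integral_def by (rule integral_scaleR_right)
  finally have lim_eq: "(LINT u|lborel. indicator {0<..} u *\<^sub>R (c * u powr \<beta>) *\<^sub>R h u) =
      c *\<^sub>R (LINT u:{0<..}|lborel. u powr \<beta> *\<^sub>R h u)" .
  have "\<forall>\<^sub>F n in sequentially. (LINT u|lborel. F n u *\<^sub>R h u) + real n *\<^sub>R (LINT x:{\<delta>..}|lborel. g n x) =
      real n *\<^sub>R (LINT x:{0<..}|lborel. g n x)"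
    by (rule eventually_sequentiallyI[of 1]) (simp add: split subst[symmetric] scaleR_add_right)
  with tendsto_add[OF near far] show ?thesis
    unfolding lim_eq g_def by (auto dest: Lim_transform_eventually)
qed

text \<open>The same majorant shows that the limit integral is a genuine one, so that its real part
  can be computed under the integral sign when nondegeneracy is proved for \<beta> < 0.\<close>

lemma scaling_limit_integrable:
  fixes h :: "real \<Rightarrow> 'b :: {banach, second_countable_topology}"
  assumes [measurable]: "h \<in> borel_measurable borel"
    and k: "1 + \<beta> < k"
    and h_le: "\<And>u. 0 < u \<Longrightarrow> norm (h u) \<le> A"
    and h_decay: "\<And>u. 0 < u \<Longrightarrow> norm (h u) \<le> A * u powr - k"
  shows "set_integrable lborel {0<..} (\<lambda>u. u powr \<beta> *\<^sub>R h u)"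
  unfolding set_integrable_def
proof (rule Bochner_Integration.integrable_bound)
  show "integrable lborel (\<lambda>u. A * (indicator {0<..} u *\<^sub>R (u powr \<beta> * min 1 (u powr - k))))"
    using set_integrable_powr_min[OF \<beta> k] unfolding set_integrable_def by simp
  show "AE u in lborel. norm (indicat_real {0<..} u *\<^sub>R u powr \<beta> *\<^sub>R h u)
      \<le> norm (A * (indicator {0<..} u *\<^sub>R (u powr \<beta> * min 1 (u powr - k))))"
  proof (rule AE_I2)
    fix u :: real
    have A: "0 \<le> A" using h_le[of 1] norm_ge_zero[of "h 1"] by linarith
    show "norm (indicat_real {0<..} u *\<^sub>R u powr \<beta> *\<^sub>R h u)
      \<le> norm (A * (indicator {0<..} u *\<^sub>R (u powr \<beta> * min 1 (u powr - k))))"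
    proof (cases "0 < u")
      case True
      have "norm (h u) \<le> A * min 1 (u powr - k)"
        using h_le[OF True] h_decay[OF True] by (auto simp: min_def)
      then have "u powr \<beta> * norm (h u) \<le> u powr \<beta> * (A * min 1 (u powr - k))"
        by (intro mult_left_mono) auto
      then show ?thesis using True A by (simp add: abs_mult mult_ac)
    qed simp
  qed
qed simp

end

section \<open>Tails of limits of sums with Cauchy tails\<close>

text \<open>Weak convergence gives convergence of distribution functions only at continuity points
  of the limit; a monotone function has countably many discontinuities, so every open interval
  contains a good point.\<close>

lemma weak_conv_continuity_point:
  assumes "real_distribution G" "weak_conv_m \<mu> G" "a < b"
  obtains x where "a < x" "x < b" "(\<lambda>n. cdf (\<mu> n) x) \<longlonglongrightarrow> cdf G x"
proof -
  interpret G: real_distribution G by fact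
  have "mono (cdf G)" by (auto intro!: monoI G.cdf_nondecreasing)
  from open_minus_countable[OF mono_ctble_discont[OF this], of "{a<..<b}"] \<open>a < b\<close>
  obtain x where "x \<in> {a<..<b}" "isCont (cdf G) x" by auto
  then show thesis
    using that assms(2) by (auto simp: weak_conv_m_def weak_conv_def)
qed

text \<open>The gap between a and b makes room for a continuity point, so the bound survives the
  limit even if a and b are atoms of the limit law.\<close>

lemma weak_conv_cdf_le:
  assumes "\<And>n. real_distribution (\<mu> n)" "real_distribution G" "weak_conv_m \<mu> G" "a < b"
    and le: "\<forall>\<^sub>F n in sequentially. cdf (\<mu> n) b \<le> v n" and v: "v \<longlonglongrightarrow> l"
  shows "cdf G a \<le> l"
proof -
  interpret G: real_distribution G by fact
  interpret real_distribution "\<mu> n" for n by fact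
  obtain x where x: "a < x" "x < b" "(\<lambda>n. cdf (\<mu> n) x) \<longlonglongrightarrow> cdf G x"
    using weak_conv_continuity_point assms(2-4) by blast
  have "cdf G a \<le> cdf G x" using x by (intro G.cdf_nondecreasing) simp
  also have "cdf G x \<le> l"
  proof (rule tendsto_le[OF _ v x(3)])
    show "\<forall>\<^sub>F n in sequentially. cdf (\<mu> n) x \<le> v n"
      using le
    proof eventually_elim
      case (elim n)
      have "cdf (\<mu> n) x \<le> cdf (\<mu> n) b" using x by (intro cdf_nondecreasing) simp
      with elim show ?case by simp
    qed
  qed simp
  finally show ?thesis .
qed

lemma weak_conv_cdf_ge:
  assumes "\<And>n. real_distribution (\<mu> n)" "real_distribution G" "weak_conv_m \<mu> G" "a < b"
    and ge: "\<forall>\<^sub>F n in sequentially. v n \<le> cdf (\<mu> n) a" and v: "v \<longlonglongrightarrow> l"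
  shows "l \<le> cdf G b"
proof -
  interpret G: real_distribution G by fact
  interpret real_distribution "\<mu> n" for n by fact
  obtain x where x: "a < x" "x < b" "(\<lambda>n. cdf (\<mu> n) x) \<longlonglongrightarrow> cdf G x"
    using weak_conv_continuity_point assms(2-4) by blast
  have "l \<le> cdf G x"
  proof (rule tendsto_le[OF _ x(3) v])
    show "\<forall>\<^sub>F n in sequentially. v n \<le> cdf (\<mu> n) x"
      using ge
    proof eventually_elim
      case (elim n)
      have "cdf (\<mu> n) a \<le> cdf (\<mu> n) x" using x by (intro cdf_nondecreasing) simp
      with elim show ?case by simp
    qed
  qed simp
  also have "cdf G x \<le> cdf G b" using x by (intro G.cdf_nondecreasing) simp
  finally show ?thesis .
qed

section \<open>Variance and Chebyshev bounds for iid sums\<close>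

lemma (in prob_space) variance_indep_sum:
  fixes X :: "'i \<Rightarrow> 'a \<Rightarrow> real"
  assumes "finite I" "indep_vars (\<lambda>_. borel) X I" "\<And>i. i \<in> I \<Longrightarrow> integrable M (\<lambda>\<omega>. (X i \<omega>)\<^sup>2)"
  shows "integrable M (\<lambda>\<omega>. (\<Sum>i\<in>I. X i \<omega>)\<^sup>2) \<and> variance (\<lambda>\<omega>. \<Sum>i\<in>I. X i \<omega>) = (\<Sum>i\<in>I. variance (X i))"
  using assms
proof (induction I rule: finite_induct)
  case (insert j I)
  have rv[measurable]: "X i \<in> borel_measurable M" if "i \<in> insert j I" for i
    using insert.prems(1) that unfolding indep_vars_def2 by auto
  let ?S = "\<lambda>\<omega>. \<Sum>i\<in>I. X i \<omega>"
  have [measurable]: "?S \<in> borel_measurable M" using rv by (intro borel_measurable_sum) auto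
  have IH: "integrable M (\<lambda>\<omega>. (?S \<omega>)\<^sup>2)" "variance ?S = (\<Sum>i\<in>I. variance (X i))"
    using insert.IH[OF indep_vars_subset[OF insert.prems(1)]] insert.prems(2) by auto
  have X2: "integrable M (\<lambda>\<omega>. (X j \<omega>)\<^sup>2)" using insert.prems by simp
  have X1: "integrable M (X j)" and S1: "integrable M ?S"
    using X2 IH(1) rv by (auto intro: square_integrable_imp_integrable)
  have ind: "indep_var borel (X j) borel ?S"
    by (rule indep_vars_sum) (use insert in auto)
  \<comment> \<open>The cross term factorises by independence of the new summand from the previous
    sum, and so cancels in the variance.\<close>
  have prod: "integrable M (\<lambda>\<omega>. X j \<omega> * ?S \<omega>)" "expectation (\<lambda>\<omega>. X j \<omega> * ?S \<omega>) = expectation (X j) * expectation ?S"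
    by (rule indep_var_integrable[OF ind X1 S1], rule indep_var_lebesgue_integral[OF ind X1 S1])
  have sq: "(\<lambda>\<omega>. (\<Sum>i\<in>insert j I. X i \<omega>)\<^sup>2) = (\<lambda>\<omega>. (X j \<omega>)\<^sup>2 + (?S \<omega>)\<^sup>2 + 2 * (X j \<omega> * ?S \<omega>))"
    using insert.hyps by (simp add: power2_sum algebra_simps)
  have int: "integrable M (\<lambda>\<omega>. (\<Sum>i\<in>insert j I. X i \<omega>)\<^sup>2)"
    unfolding sq using X2 IH(1) prod(1) by auto
  have int1: "integrable M (\<lambda>\<omega>. \<Sum>i\<in>insert j I. X i \<omega>)"
    using insert.hyps X1 S1 by simp
  have "variance (\<lambda>\<omega>. \<Sum>i\<in>insert j I. X i \<omega>) = variance (X j) + variance ?S"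
    unfolding variance_eq[OF int1 int] variance_eq[OF X1 X2] variance_eq[OF S1 IH(1)]
    unfolding sq using insert.hyps X1 S1 X2 IH(1) prod by (simp add: power2_sum)
  then show ?case using int insert.hyps IH(2) by simp
qed (simp add: prob_space)

text \<open>The variance is majorised by the second moment because the scaling limit delivers
  truncated second moments directly.\<close>

lemma (in prob_space) iid_sum_chebyshev:
  assumes "iid M X" "integrable M (\<lambda>\<omega>. (X 0 \<omega>)\<^sup>2)" "0 < s"
  shows "prob {\<omega> \<in> space M. s \<le> \<bar>(\<Sum>i<n. X i \<omega>) - real n * expectation (X 0)\<bar>}
    \<le> real n * expectation (\<lambda>\<omega>. (X 0 \<omega>)\<^sup>2) / s\<^sup>2"
proof -
  note ind = iidD(2)[OF assms(1)] and id = iidD(4)[OF assms(1)] and [measurable] = iidD(3)[OF assms(1)]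
  have same: "expectation (\<lambda>\<omega>. g (X i \<omega>)) = expectation (\<lambda>\<omega>. g (X 0 \<omega>))"
    if [measurable]: "g \<in> borel_measurable borel" for i and g :: "real \<Rightarrow> real"
  proof -
    have "expectation (\<lambda>\<omega>. g (X j \<omega>)) = (\<integral>x. g x \<partial>distr M borel (X j))" for j
      by (subst integral_distr) auto
    then show ?thesis using id[of i] by metis
  qed
  have mean: "expectation (X i) = expectation (X 0)" for i
    using same[of "\<lambda>x. x"] by simp
  have int: "integrable M (\<lambda>\<omega>. (X i \<omega>)\<^sup>2)" for i
  proof -
    have "integrable M (\<lambda>\<omega>. (X j \<omega>)\<^sup>2) \<longleftrightarrow> integrable (distr M borel (X j)) (\<lambda>x. x\<^sup>2)" for j
      by (subst integrable_distr_eq) auto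
    then show ?thesis using id[of i] assms(2) by metis
  qed
  have int1: "integrable M (X i)" for i
    using int by (auto intro: square_integrable_imp_integrable)
  have var: "variance (X i) \<le> expectation (\<lambda>\<omega>. (X 0 \<omega>)\<^sup>2)" for i
    using variance_eq[OF int1 int, of i] same[of "\<lambda>x. x\<^sup>2" i] by simp
  note sum = variance_indep_sum[OF finite_lessThan indep_vars_subset[OF ind subset_UNIV] int, of n]
  have mean_sum: "expectation (\<lambda>\<omega>. \<Sum>i<n. X i \<omega>) = real n * expectation (X 0)"
  proof -
    have "expectation (\<lambda>\<omega>. \<Sum>i<n. X i \<omega>) = (\<Sum>i<n. expectation (X i))"
      using int1 by simp
    also have "\<dots> = (\<Sum>i<n. expectation (X 0))" by (rule sum.cong[OF refl mean])
    finally show ?thesis by simp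
  qed
  have "(\<Sum>i<n. variance (X i)) \<le> (\<Sum>i<n. expectation (\<lambda>\<omega>. (X 0 \<omega>)\<^sup>2))"
    by (rule sum_mono) (rule var)
  then have le: "variance (\<lambda>\<omega>. \<Sum>i<n. X i \<omega>) \<le> real n * expectation (\<lambda>\<omega>. (X 0 \<omega>)\<^sup>2)"
    using sum by simp
  have "prob {\<omega> \<in> space M. s \<le> \<bar>(\<Sum>i<n. X i \<omega>) - expectation (\<lambda>\<omega>. \<Sum>i<n. X i \<omega>)\<bar>}
      \<le> variance (\<lambda>\<omega>. \<Sum>i<n. X i \<omega>) / s\<^sup>2"
    by (rule Chebyshev_inequality) (use sum assms(3) in auto)
  also have "\<dots> \<le> real n * expectation (\<lambda>\<omega>. (X 0 \<omega>)\<^sup>2) / s\<^sup>2"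
    using le by (intro divide_right_mono) auto
  finally show ?thesis unfolding mean_sum .
qed

text \<open>Large values are replaced by 0, not capped at t, so that a sum splits exactly into its
  truncated part and the sum of its large terms.\<close>

definition trunc_above :: "real \<Rightarrow> real \<Rightarrow> real" where
  "trunc_above t x = (if x \<le> t then x else 0)"

lemma trunc_above_measurable[measurable]: "trunc_above t \<in> borel_measurable borel"
  unfolding trunc_above_def by measurable

text \<open>The level of truncation is proportional to n, the size of a typical large summand. The
  three limits are the mass, the second moment and the centred mean of the limiting jump measure c
  u^(-2) du, cut at y. The constant L is the limiting offset of \<open>b n\<close> from the mean
  truncated at level n, as y = 1 shows.\<close>

locale cauchy_tailed_iid = prob_space M for M :: "'a measure" +
  fixes X :: "nat \<Rightarrow> 'a \<Rightarrow> real" and c L :: real and b :: "nat \<Rightarrow> real"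
  assumes iid: "iid M X"
    and nonneg: "\<And>i \<omega>. \<omega> \<in> space M \<Longrightarrow> 0 \<le> X i \<omega>"
    and c_pos: "0 < c"
    and tail_lim: "\<And>y. 0 < y \<Longrightarrow> (\<lambda>n. real n * prob {\<omega> \<in> space M. real n * y < X 0 \<omega>}) \<longlonglongrightarrow> c / y"
    and trunc_second_moment_lim: "\<And>y. 0 < y \<Longrightarrow>
      (\<lambda>n. real n * expectation (\<lambda>\<omega>. (trunc_above (real n * y) (X 0 \<omega>) / real n)\<^sup>2)) \<longlonglongrightarrow> c * y"
    and trunc_mean_lim: "\<And>y. 0 < y \<Longrightarrow>
      (\<lambda>n. real n * expectation (\<lambda>\<omega>. trunc_above (real n * y) (X 0 \<omega>) / real n) - b n) \<longlonglongrightarrow> c * ln y - L"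
begin

lemmas X_measurable[measurable] = iidD(3)[OF iid]

definition S where "S n \<omega> = 1 / real n * (\<Sum>i<n. X i \<omega>) - b n"
definition W where "W n y \<omega> = (\<Sum>i<n. trunc_above (real n * y) (X i \<omega>) / real n)"
definition m where "m n y = real n * expectation (\<lambda>\<omega>. trunc_above (real n * y) (X 0 \<omega>) / real n)"
definition V where "V n y = real n * expectation (\<lambda>\<omega>. (trunc_above (real n * y) (X 0 \<omega>) / real n)\<^sup>2)"
definition p where "p n y = prob {\<omega> \<in> space M. real n * y < X 0 \<omega>}"

lemma S_measurable[measurable]: "S n \<in> borel_measurable M"
  unfolding S_def by measurable

lemma W_measurable[measurable]: "W n y \<in> borel_measurable M"
  unfolding W_def by measurable

section \<open>Bounds for the normalised sum at finite n\<close>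

lemma W_chebyshev:
  assumes "0 < s" "0 < y"
  shows "prob {\<omega> \<in> space M. s \<le> \<bar>W n y \<omega> - m n y\<bar>} \<le> V n y / s\<^sup>2"
proof -
  have "iid M (\<lambda>i \<omega>. trunc_above (real n * y) (X i \<omega>) / real n)"
    by (rule iid_compose[OF iid]) simp
  moreover have "integrable M (\<lambda>\<omega>. (trunc_above (real n * y) (X 0 \<omega>) / real n)\<^sup>2)"
  proof (rule integrable_const_bound[of _ "y\<^sup>2"])
    show "AE \<omega> in M. norm ((trunc_above (real n * y) (X 0 \<omega>) / real n)\<^sup>2) \<le> y\<^sup>2"
    proof (rule AE_I2)
      fix \<omega> assume "\<omega> \<in> space M"
      then have "\<bar>trunc_above (real n * y) (X 0 \<omega>) / real n\<bar> \<le> y"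
        using nonneg[of \<omega> 0] assms by (auto simp: trunc_above_def divide_le_eq mult.commute)
      then show "norm ((trunc_above (real n * y) (X 0 \<omega>) / real n)\<^sup>2) \<le> y\<^sup>2"
        using assms by (simp add: abs_le_square_iff[symmetric])
    qed
  qed simp
  ultimately show ?thesis
    unfolding W_def m_def V_def using iid_sum_chebyshev assms(1) by blast
qed

lemma prob_X: "prob {\<omega> \<in> space M. real n * y < X i \<omega>} = p n y"
proof -
  have "prob {\<omega> \<in> space M. real n * y < X j \<omega>} = measure (distr M borel (X j)) {real n * y <..}" for j
    by (subst measure_distr) (auto intro!: arg_cong[of _ _ prob])
  then show ?thesis unfolding p_def using iidD(4)[OF iid, of i] by metis
qed

lemma prob_X_pair:
  assumes "i \<noteq> j"
  shows "prob {\<omega> \<in> space M. real n * y < X i \<omega> \<and> real n * y < X j \<omega>} = (p n y)\<^sup>2"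
proof -
  have "prob (\<Inter>k\<in>{i, j}. X k -` {real n * y <..} \<inter> space M) = (\<Prod>k\<in>{i, j}. prob (X k -` {real n * y <..} \<inter> space M))"
    by (rule indep_varsD[OF iidD(2)[OF iid]]) auto
  moreover have "X k -` {real n * y <..} \<inter> space M = {\<omega> \<in> space M. real n * y < X k \<omega>}" for k by auto
  moreover have "(\<Inter>k\<in>{i, j}. {\<omega> \<in> space M. real n * y < X k \<omega>}) =
      {\<omega> \<in> space M. real n * y < X i \<omega> \<and> real n * y < X j \<omega>}" by auto
  ultimately show ?thesis using assms by (simp add: prob_X power2_eq_square)
qed

lemma prob_all_le: "prob {\<omega> \<in> space M. \<forall>i<n. X i \<omega> \<le> real n * y} \<le> exp (- (real n * p n y))"
proof (cases "n = 0")
  case False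
  have "prob {\<omega> \<in> space M. \<forall>i<n. X i \<omega> \<le> real n * y} = prob (\<Inter>i\<in>{..<n}. X i -` {..real n * y} \<inter> space M)"
    using False by (intro arg_cong[of _ _ prob]) auto
  also have "\<dots> = (\<Prod>i<n. prob (X i -` {..real n * y} \<inter> space M))"
    by (rule indep_varsD[OF iidD(2)[OF iid]]) (use False in auto)
  also have "\<dots> = (\<Prod>i<n. 1 - p n y)"
  proof (rule prod.cong[OF refl])
    fix i
    have "X i -` {..real n * y} \<inter> space M = space M - {\<omega> \<in> space M. real n * y < X i \<omega>}" by auto
    then show "prob (X i -` {..real n * y} \<inter> space M) = 1 - p n y"
      by (simp add: prob_compl prob_X)
  qed
  also have "\<dots> = (1 - p n y) ^ n" by simp
  also have "\<dots> \<le> exp (- p n y) ^ n"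
    using exp_ge_add_one_self[of "- p n y"] by (intro power_mono) (auto simp: p_def)
  also have "\<dots> = exp (- (real n * p n y))" by (simp add: exp_of_nat_mult[symmetric])
  finally show ?thesis .
qed simp

lemma W_le: "\<omega> \<in> space M \<Longrightarrow> W n y \<omega> \<le> 1 / real n * (\<Sum>i<n. X i \<omega>)"
  unfolding W_def sum_distrib_left
  by (intro sum_mono) (auto simp: trunc_above_def divide_right_mono nonneg)

text \<open>Nonnegative summands cannot make the sum small through large terms: the truncated sum is
  below the full one, so S \<le> -t forces \<open>W n y\<close> to lie at least t + (m n y - b n)
  below its mean.\<close>

lemma prob_left:
  assumes "0 < y" "0 < t + (m n y - b n)"
  shows "prob {\<omega> \<in> space M. S n \<omega> \<le> - t} \<le> V n y / (t + (m n y - b n))\<^sup>2"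
proof -
  have "prob {\<omega> \<in> space M. S n \<omega> \<le> - t} \<le>
      prob {\<omega> \<in> space M. t + (m n y - b n) \<le> \<bar>W n y \<omega> - m n y\<bar>}"
    by (rule finite_measure_mono) (use W_le[of _ n y] in \<open>force simp: S_def\<close>, simp)
  also have "\<dots> \<le> V n y / (t + (m n y - b n))\<^sup>2"
    by (rule W_chebyshev) fact+
  finally show ?thesis .
qed

text \<open>Up to small probability at most one summand exceeds \<open>y\<close>, and the rest of the sum is
  concentrated around its mean.\<close>

lemma prob_right_le:
  assumes "0 < y" "0 < r" "0 < d - (m n y - b n)"
  shows "prob {\<omega> \<in> space M. r + d < S n \<omega>} \<le>
    real n * p n r + (real n * p n y)\<^sup>2 + V n y / (d - (m n y - b n))\<^sup>2"
proof -
  \<comment> \<open>Three ways to be large: one summand above n r, two summands above n y, or a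
    truncated sum far above its mean.\<close>
  define A where "A = (\<Union>i\<in>{..<n}. {\<omega> \<in> space M. real n * r < X i \<omega>})"
  define B where "B = (\<Union>(i, j)\<in>{(i, j). i < n \<and> j < n \<and> i \<noteq> j}.
    {\<omega> \<in> space M. real n * y < X i \<omega> \<and> real n * y < X j \<omega>})"
  define C where "C = {\<omega> \<in> space M. d - (m n y - b n) \<le> \<bar>W n y \<omega> - m n y\<bar>}"
  have fin: "finite {(i, j). i < n \<and> j < n \<and> i \<noteq> j}"
    by (rule finite_subset[of _ "{..<n} \<times> {..<n}"]) auto
  have [measurable]: "A \<in> sets M" "C \<in> sets M"
    unfolding A_def C_def by measurable
  have [measurable]: "B \<in> sets M"
    unfolding B_def using fin by (intro sets.finite_UN) auto
  have "prob A \<le> (\<Sum>i<n. prob {\<omega> \<in> space M. real n * r < X i \<omega>})"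
    unfolding A_def by (rule finite_measure_subadditive_finite) auto
  then have A: "prob A \<le> real n * p n r" by (simp add: prob_X)
  have "prob B \<le> (\<Sum>(i, j)\<in>{(i, j). i < n \<and> j < n \<and> i \<noteq> j}.
      prob {\<omega> \<in> space M. real n * y < X i \<omega> \<and> real n * y < X j \<omega>})"
    unfolding B_def using fin
    by (intro order_trans[OF finite_measure_subadditive_finite]) (auto simp: case_prod_beta)
  also have "\<dots> = (\<Sum>(i, j)\<in>{(i, j). i < n \<and> j < n \<and> i \<noteq> j}. (p n y)\<^sup>2)"
    by (rule sum.cong) (auto simp: prob_X_pair)
  also have "\<dots> \<le> (\<Sum>(i, j)\<in>{..<n} \<times> {..<n}. (p n y)\<^sup>2)"
    by (rule sum_mono2) auto
  also have "\<dots> = (real n * p n y)\<^sup>2" by (simp add: power2_eq_square)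
  finally have B: "prob B \<le> (real n * p n y)\<^sup>2" .
  have C: "prob C \<le> V n y / (d - (m n y - b n))\<^sup>2"
    unfolding C_def by (rule W_chebyshev) fact+
  have "{\<omega> \<in> space M. r + d < S n \<omega>} \<subseteq> (A \<union> B) \<union> C"
  proof (rule subsetI, rule ccontr)
    fix \<omega> assume w: "\<omega> \<in> {\<omega> \<in> space M. r + d < S n \<omega>}" and out: "\<omega> \<notin> (A \<union> B) \<union> C"
    then have sp: "\<omega> \<in> space M" by simp
    define J where "J = {i \<in> {..<n}. real n * y < X i \<omega>}"
    have "(\<Sum>i\<in>J. X i \<omega> / real n) \<le> r"
    proof (cases "J = {}")
      case False
      then obtain j where j: "j \<in> J" by blast
      \<comment> \<open>Outside \<open>B\<close> at most one index is large, and outside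
        \<open>A\<close> its summand contributes at most r.\<close>
      have "J = {j}" using out sp j by (auto simp: J_def B_def)
      moreover have "X j \<omega> \<le> real n * r" using out sp j by (auto simp: J_def A_def not_less)
      moreover have "0 < n" using j by (auto simp: J_def)
      ultimately show ?thesis by (simp add: divide_le_eq mult.commute)
    qed (use assms in simp)
    moreover have "1 / real n * (\<Sum>i<n. X i \<omega>) = W n y \<omega> + (\<Sum>i\<in>J. X i \<omega> / real n)"
    proof -
      have "(\<Sum>i\<in>J. X i \<omega> / real n) = (\<Sum>i<n. if real n * y < X i \<omega> then X i \<omega> / real n else 0)"
        unfolding J_def by (rule sum.inter_filter) simp
      then show ?thesis
        unfolding W_def sum_distrib_left
        by (auto simp: sum.distrib[symmetric] trunc_above_def intro!: sum.cong)
    qed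
    ultimately have "r + d < W n y \<omega> + r - b n" using w by (simp add: S_def)
    then show False using out sp by (auto simp: C_def)
  qed
  then have "prob {\<omega> \<in> space M. r + d < S n \<omega>} \<le> prob ((A \<union> B) \<union> C)"
    by (rule finite_measure_mono) simp
  also have "\<dots> \<le> prob (A \<union> B) + prob C" by (rule measure_Un_le) auto
  also have "prob (A \<union> B) \<le> prob A + prob B" by (rule measure_Un_le) auto
  finally show ?thesis using A B C by linarith
qed

text \<open>One summand above n r lifts the normalised sum beyond r - d unless the others are
  unusually small. Since y \<le> r this summand does not enter \<open>W n y\<close>, so the
  truncated sum measures only the others.\<close>

lemma prob_right_ge:
  assumes "0 < y" "y \<le> r" "0 < d + (m n y - b n)"
  shows "prob {\<omega> \<in> space M. S n \<omega> \<le> r - d} \<le> exp (- (real n * p n r)) + V n y / (d + (m n y - b n))\<^sup>2"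
proof -
  define A where "A = {\<omega> \<in> space M. \<forall>i<n. X i \<omega> \<le> real n * r}"
  define C where "C = {\<omega> \<in> space M. d + (m n y - b n) \<le> \<bar>W n y \<omega> - m n y\<bar>}"
  have [measurable]: "A \<in> sets M" "C \<in> sets M"
    unfolding A_def C_def by measurable
  have "{\<omega> \<in> space M. S n \<omega> \<le> r - d} \<subseteq> A \<union> C"
  proof (rule subsetI, rule ccontr)
    fix \<omega> assume w: "\<omega> \<in> {\<omega> \<in> space M. S n \<omega> \<le> r - d}" and out: "\<omega> \<notin> A \<union> C"
    then have sp: "\<omega> \<in> space M" by simp
    from out sp obtain j where j: "j < n" "real n * r < X j \<omega>" by (auto simp: A_def not_le)
    have "real n * y \<le> real n * r" using assms by (intro mult_left_mono) auto
    with j(2) have zero: "trunc_above (real n * y) (X j \<omega>) = 0"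
      by (auto simp: trunc_above_def)
    have "W n y \<omega> = (\<Sum>i\<in>{..<n} - {j}. trunc_above (real n * y) (X i \<omega>) / real n)"
      unfolding W_def using j zero by (subst sum.remove[of _ j]) auto
    also have "\<dots> \<le> (\<Sum>i\<in>{..<n} - {j}. X i \<omega> / real n)"
      using sp by (intro sum_mono) (auto simp: trunc_above_def divide_right_mono nonneg)
    also have "\<dots> = 1 / real n * (\<Sum>i<n. X i \<omega>) - X j \<omega> / real n"
      unfolding sum_distrib_left using j by (subst (2) sum.remove[of _ j]) auto
    also have "\<dots> < 1 / real n * (\<Sum>i<n. X i \<omega>) - r"
      using j by (simp add: less_divide_eq mult.commute)
    finally have "W n y \<omega> < b n - d" using w by (simp add: S_def)
    then show False using out sp by (auto simp: C_def)
  qed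
  then have "prob {\<omega> \<in> space M. S n \<omega> \<le> r - d} \<le> prob (A \<union> C)"
    by (rule finite_measure_mono) simp
  also have "\<dots> \<le> prob A + prob C" by (rule measure_Un_le) auto
  also have "prob A \<le> exp (- (real n * p n r))" unfolding A_def by (rule prob_all_le)
  also have "prob C \<le> V n y / (d + (m n y - b n))\<^sup>2"
    unfolding C_def by (rule W_chebyshev) fact+
  finally show ?thesis by simp
qed

section \<open>Passage to the limit law\<close>

lemma cdf_S: "cdf (distr M borel (S n)) t = prob {\<omega> \<in> space M. S n \<omega> \<le> t}"
  unfolding cdf_def by (subst measure_distr) (auto intro!: arg_cong[of _ _ prob])

context
  fixes G :: "real measure"
  assumes G: "real_distribution G" and conv: "weak_conv_m (\<lambda>n. distr M borel (S n)) G"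
begin

interpretation G: real_distribution G by (rule G)

lemmas cdf_le = weak_conv_cdf_le[OF real_distribution_distr[OF S_measurable] G conv]
  and cdf_ge = weak_conv_cdf_ge[OF real_distribution_distr[OF S_measurable] G conv]

lemmas lims = tail_lim[folded p_def] trunc_second_moment_lim[folded V_def] trunc_mean_lim[folded m_def]

lemma cdf_left_bound:
  assumes "0 < y" "t < u" "0 < t + (c * ln y - L)"
  shows "cdf G (- u) \<le> c * y / (t + (c * ln y - L))\<^sup>2"
proof (rule cdf_le)
  show "- u < - t" using assms by simp
  have lim: "(\<lambda>n. t + (m n y - b n)) \<longlonglongrightarrow> t + (c * ln y - L)"
    by (intro tendsto_intros lims assms)
  show "\<forall>\<^sub>F n in sequentially. cdf (distr M borel (S n)) (- t) \<le> V n y / (t + (m n y - b n))\<^sup>2"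
    using order_tendstoD(1)[OF lim assms(3)] unfolding cdf_S
    by eventually_elim (use assms in \<open>auto intro: prob_left\<close>)
  show "(\<lambda>n. V n y / (t + (m n y - b n))\<^sup>2) \<longlonglongrightarrow> c * y / (t + (c * ln y - L))\<^sup>2"
    by (intro tendsto_divide lims tendsto_power lim) (use assms in auto)
qed

text \<open>The limit n to infinity of \<open>prob_right_le\<close>: n p n r tends to c / r, V n y
  to c y and m n y - b n to c ln y - L. The parameters y, r and d remain free and are tied to t only
  afterwards.\<close>

lemma cdf_right_upper:
  assumes "0 < y" "0 < r" "r + d < t" "0 < d - (c * ln y - L)"
  shows "1 - cdf G t \<le> c / r + (c / y)\<^sup>2 + c * y / (d - (c * ln y - L))\<^sup>2"
proof -
  have lim: "(\<lambda>n. d - (m n y - b n)) \<longlonglongrightarrow> d - (c * ln y - L)"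
    by (intro tendsto_intros lims assms)
  have "1 - (c / r + (c / y)\<^sup>2 + c * y / (d - (c * ln y - L))\<^sup>2) \<le> cdf G t"
  proof (rule cdf_ge)
    show "r + d < t" by fact
    show "\<forall>\<^sub>F n in sequentially. 1 - (real n * p n r + (real n * p n y)\<^sup>2 + V n y / (d - (m n y - b n))\<^sup>2)
        \<le> cdf (distr M borel (S n)) (r + d)"
      using order_tendstoD(1)[OF lim assms(4)]
    proof eventually_elim
      case (elim n)
      have "{\<omega> \<in> space M. S n \<omega> \<le> r + d} = space M - {\<omega> \<in> space M. r + d < S n \<omega>}" by auto
      then have "cdf (distr M borel (S n)) (r + d) = 1 - prob {\<omega> \<in> space M. r + d < S n \<omega>}"
        unfolding cdf_S by (simp add: prob_compl)
      then show ?case using prob_right_le[of y r d n] assms elim by simp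
    qed
    show "(\<lambda>n. 1 - (real n * p n r + (real n * p n y)\<^sup>2 + V n y / (d - (m n y - b n))\<^sup>2))
        \<longlonglongrightarrow> 1 - (c / r + (c / y)\<^sup>2 + c * y / (d - (c * ln y - L))\<^sup>2)"
      by (intro tendsto_diff tendsto_add tendsto_const tendsto_divide lims tendsto_power lim)
        (use assms in auto)
  qed
  then show ?thesis by simp
qed

lemma cdf_right_lower:
  assumes "0 < y" "y \<le> r" "t < r - d" "0 < d + (c * ln y - L)"
  shows "1 - exp (- (c / r)) - c * y / (d + (c * ln y - L))\<^sup>2 \<le> 1 - cdf G t"
proof -
  have lim: "(\<lambda>n. d + (m n y - b n)) \<longlonglongrightarrow> d + (c * ln y - L)"
    by (intro tendsto_intros lims assms)
  have "cdf G t \<le> exp (- (c / r)) + c * y / (d + (c * ln y - L))\<^sup>2"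
  proof (rule cdf_le)
    show "t < r - d" by fact
    show "\<forall>\<^sub>F n in sequentially. cdf (distr M borel (S n)) (r - d) \<le>
        exp (- (real n * p n r)) + V n y / (d + (m n y - b n))\<^sup>2"
      using order_tendstoD(1)[OF lim assms(4)] unfolding cdf_S
      by eventually_elim (use assms in \<open>auto intro: prob_right_ge\<close>)
    show "(\<lambda>n. exp (- (real n * p n r)) + V n y / (d + (m n y - b n))\<^sup>2)
        \<longlonglongrightarrow> exp (- (c / r)) + c * y / (d + (c * ln y - L))\<^sup>2"
      by (intro tendsto_add tendsto_divide tendsto_exp tendsto_minus lims tendsto_power lim)
        (use assms in auto)
  qed
  then show ?thesis by simp
qed

theorem left_tail: "((\<lambda>t. t * cdf G (- t)) \<longlongrightarrow> 0) at_top"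
proof (rule tendstoI)
  fix e :: real assume e: "0 < e"
  \<comment> \<open>With truncation at \<epsilon> t and half of t kept as deviation, t times the
    Chebyshev bound tends to 4 c \<epsilon>; this value makes it e / 2. The logarithmic centering is
    negligible against t.\<close>
  define \<epsilon> where "\<epsilon> = e / (8 * c)"
  have \<epsilon>: "0 < \<epsilon>" "4 * c * \<epsilon> < e" using e c_pos by (auto simp: \<epsilon>_def)
  have "((\<lambda>t. t * (c * (\<epsilon> * t) / (t / 2 + (c * ln (\<epsilon> * t) - L))\<^sup>2)) \<longlongrightarrow> 4 * c * \<epsilon>) at_top"
    using \<epsilon>(1) c_pos by (real_asymp simp: power2_eq_square)
  from order_tendstoD(2)[OF this \<epsilon>(2)]
  have "\<forall>\<^sub>F t in at_top. t * (c * (\<epsilon> * t) / (t / 2 + (c * ln (\<epsilon> * t) - L))\<^sup>2) < e" .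
  moreover have "\<forall>\<^sub>F t in at_top. 0 < t / 2 + (c * ln (\<epsilon> * t) - L)"
    using \<epsilon>(1) c_pos by real_asymp
  ultimately show "\<forall>\<^sub>F t in at_top. dist (t * cdf G (- t)) 0 < e"
    using eventually_gt_at_top[of 0]
  proof eventually_elim
    case (elim t)
    have "t * cdf G (- t) \<le> t * (c * (\<epsilon> * t) / (t / 2 + (c * ln (\<epsilon> * t) - L))\<^sup>2)"
      by (intro mult_left_mono cdf_left_bound) (use elim \<epsilon> in auto)
    then show ?case using elim by (simp add: G.cdf_nonneg)
  qed
qed

theorem right_tail: "((\<lambda>t. t * (1 - cdf G t)) \<longlongrightarrow> c) at_top"
proof (rule order_tendstoI)
  fix a assume "a < c"
  have "((\<lambda>\<delta>. c / (1 + 2 * \<delta>) - c * \<delta>) \<longlongrightarrow> c) (at_right 0)"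
    by real_asymp
  from order_tendstoD(1)[OF this \<open>a < c\<close>]
  have "\<forall>\<^sub>F \<delta> in at_right 0. a < c / (1 + 2 * \<delta>) - c * \<delta> \<and> 0 < \<delta> \<and> \<delta> < 1"
    by (intro eventually_conj eventually_at_right_less) (auto simp: eventually_at_right_field intro: exI[of _ 1])
  then obtain \<delta> :: real where \<delta>: "a < c / (1 + 2 * \<delta>) - c * \<delta>" "0 < \<delta>" "\<delta> < 1"
    using eventually_happens'[OF trivial_limit_at_right_real] by blast
  have "\<delta> ^ 3 \<le> 1" using \<delta> by (simp add: power_le_one)
  \<comment> \<open>The parameters are r = (1 + 2 \<delta>) t, d = \<delta> t and y = \<delta>^3 t.
    The cube matters: t times the Chebyshev error tends to c \<delta>^3 / \<delta>^2 = c \<delta>,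
    which vanishes with \<delta>.\<close>
  have "((\<lambda>t. t * (1 - exp (- (c / ((1 + 2 * \<delta>) * t))) -
      c * (\<delta> ^ 3 * t) / (\<delta> * t + (c * ln (\<delta> ^ 3 * t) - L))\<^sup>2)) \<longlongrightarrow> c / (1 + 2 * \<delta>) - c * \<delta>) at_top"
    using \<delta>(2) c_pos by (real_asymp simp: field_simps power2_eq_square power3_eq_cube)
  from order_tendstoD(1)[OF this \<delta>(1)]
  have "\<forall>\<^sub>F t in at_top. a < t * (1 - exp (- (c / ((1 + 2 * \<delta>) * t))) -
      c * (\<delta> ^ 3 * t) / (\<delta> * t + (c * ln (\<delta> ^ 3 * t) - L))\<^sup>2)" .
  moreover have "\<forall>\<^sub>F t in at_top. 0 < \<delta> * t + (c * ln (\<delta> ^ 3 * t) - L)"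
    using \<delta>(2) c_pos by real_asymp
  ultimately show "\<forall>\<^sub>F t in at_top. a < t * (1 - cdf G t)"
    using eventually_gt_at_top[of 0]
  proof eventually_elim
    case (elim t)
    have "t * (1 - exp (- (c / ((1 + 2 * \<delta>) * t))) -
      c * (\<delta> ^ 3 * t) / (\<delta> * t + (c * ln (\<delta> ^ 3 * t) - L))\<^sup>2) \<le> t * (1 - cdf G t)"
    proof (intro mult_left_mono cdf_right_lower)
      show "\<delta> ^ 3 * t \<le> (1 + 2 * \<delta>) * t"
        using elim \<delta> \<open>\<delta> ^ 3 \<le> 1\<close> by (intro mult_right_mono) auto
    qed (use elim \<delta> in \<open>auto simp: algebra_simps\<close>)
    then show ?case using elim(1) by linarith
  qed
next
  fix a assume "c < a"
  have "((\<lambda>\<delta>. c / (1 - 2 * \<delta>) + c * \<delta>) \<longlongrightarrow> c) (at_right 0)"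
    by real_asymp
  from order_tendstoD(2)[OF this \<open>c < a\<close>]
  have "\<forall>\<^sub>F \<delta> in at_right 0. c / (1 - 2 * \<delta>) + c * \<delta> < a \<and> 0 < \<delta> \<and> \<delta> < 1 / 4"
    by (intro eventually_conj eventually_at_right_less) (auto simp: eventually_at_right_field intro: exI[of _ "1 / 4"])
  then obtain \<delta> :: real where \<delta>: "c / (1 - 2 * \<delta>) + c * \<delta> < a" "0 < \<delta>" "\<delta> < 1 / 4"
    using eventually_happens'[OF trivial_limit_at_right_real] by blast
  have pos: "0 < 1 - 2 * \<delta>" using \<delta> by simp
  \<comment> \<open>Here r = (1 - 2 \<delta>) t, so that r + d = (1 - \<delta>) t lies below t. The
    contribution of two large summands is of order t^(-2) and disappears after multiplication by
    t.\<close>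
  have "((\<lambda>t. t * (c / ((1 - 2 * \<delta>) * t) + (c / (\<delta> ^ 3 * t))\<^sup>2 +
      c * (\<delta> ^ 3 * t) / (\<delta> * t - (c * ln (\<delta> ^ 3 * t) - L))\<^sup>2)) \<longlongrightarrow> c / (1 - 2 * \<delta>) + c * \<delta>) at_top"
    using \<delta>(2) pos c_pos by (real_asymp simp: field_simps power2_eq_square power3_eq_cube)
  from order_tendstoD(2)[OF this \<delta>(1)]
  have "\<forall>\<^sub>F t in at_top. t * (c / ((1 - 2 * \<delta>) * t) + (c / (\<delta> ^ 3 * t))\<^sup>2 +
      c * (\<delta> ^ 3 * t) / (\<delta> * t - (c * ln (\<delta> ^ 3 * t) - L))\<^sup>2) < a" .
  moreover have "\<forall>\<^sub>F t in at_top. 0 < \<delta> * t - (c * ln (\<delta> ^ 3 * t) - L)"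
    using \<delta>(2) c_pos by real_asymp
  ultimately show "\<forall>\<^sub>F t in at_top. t * (1 - cdf G t) < a"
    using eventually_gt_at_top[of 0]
  proof eventually_elim
    case (elim t)
    have "t * (1 - cdf G t) \<le> t * (c / ((1 - 2 * \<delta>) * t) + (c / (\<delta> ^ 3 * t))\<^sup>2 +
      c * (\<delta> ^ 3 * t) / (\<delta> * t - (c * ln (\<delta> ^ 3 * t) - L))\<^sup>2)"
      by (intro mult_left_mono cdf_right_upper) (use elim \<delta> pos in \<open>auto simp: algebra_simps\<close>)
    then show ?case using elim(1) by linarith
  qed
qed

end

end

section \<open>Means of reciprocals\<close>

lemma char_return: "char (return borel a) t = iexp (t * a)"
  unfolding char_def by (subst integral_return) auto

lemma real_distribution_return: "real_distribution (return borel (a :: real))"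
  by (simp add: real_distribution_def real_distribution_axioms_def prob_space_return)

text \<open>Only a first moment is available. It suffices for dominated convergence of n (exp (i t X
  / n) - 1), which is bounded by |t X| and tends to i t X.\<close>

lemma (in prob_space) iid_weak_law:
  assumes "iid M X" and int: "integrable M (X 0)"
  shows "weak_conv_m (\<lambda>n. distr M borel (\<lambda>\<omega>. 1 / real n * (\<Sum>i<n. X i \<omega>))) (return borel (expectation (X 0)))"
proof (rule levy_continuity)
  note [measurable] = iidD(3)[OF assms(1)]
  show "real_distribution (distr M borel (\<lambda>\<omega>. 1 / real n * (\<Sum>i<n. X i \<omega>)))" for n
    by (rule real_distribution_distr) simp
  show "real_distribution (return borel (expectation (X 0)))" by (rule real_distribution_return)
  fix t
  interpret \<mu>: real_distribution "distr M borel (X 0)" by (rule real_distribution_distr) simp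
  have lim: "(\<lambda>n. CLINT \<omega>|M. of_nat n * (iexp (1 / real n * t * X 0 \<omega>) - 1)) \<longlonglongrightarrow> (CLINT \<omega>|M. \<i> * (t * X 0 \<omega>))"
  proof (rule integral_dominated_convergence)
    show "integrable M (\<lambda>\<omega>. \<bar>t\<bar> * \<bar>X 0 \<omega>\<bar>)" using int by simp
    show "AE \<omega> in M. cmod (of_nat n * (iexp (1 / real n * t * X 0 \<omega>) - 1)) \<le> \<bar>t\<bar> * \<bar>X 0 \<omega>\<bar>" for n
    proof (rule AE_I2)
      fix \<omega>
      have "cmod (iexp (1 / real n * t * X 0 \<omega>) - 1) \<le> \<bar>1 / real n * t * X 0 \<omega>\<bar>"
        using iexp_approx1[of "1 / real n * t * X 0 \<omega>" 0] by simp
      then have "real n * cmod (iexp (1 / real n * t * X 0 \<omega>) - 1) \<le> real n * \<bar>1 / real n * t * X 0 \<omega>\<bar>"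
        by (intro mult_left_mono) auto
      also have "\<dots> \<le> \<bar>t\<bar> * \<bar>X 0 \<omega>\<bar>" by (simp add: abs_mult)
      finally show "cmod (of_nat n * (iexp (1 / real n * t * X 0 \<omega>) - 1)) \<le> \<bar>t\<bar> * \<bar>X 0 \<omega>\<bar>"
        by (simp add: norm_mult)
    qed
    show "AE \<omega> in M. (\<lambda>n. of_nat n * (iexp (1 / real n * t * X 0 \<omega>) - 1)) \<longlonglongrightarrow> \<i> * (t * X 0 \<omega>)"
    proof (rule AE_I2)
      fix \<omega>
      define y where "y = t * X 0 \<omega>"
      have "(\<lambda>n. of_nat n * (iexp (1 / real n * t * X 0 \<omega>) - 1) - \<i> * y) \<longlonglongrightarrow> 0"
      proof (rule Lim_null_comparison)
        show "\<forall>\<^sub>F n in sequentially. cmod (of_nat n * (iexp (1 / real n * t * X 0 \<omega>) - 1) - \<i> * y) \<le> y\<^sup>2 / 2 / real n"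
        proof (rule eventually_sequentiallyI[of 1])
          fix n :: nat assume n: "1 \<le> n"
          have eq: "of_nat n * (iexp (1 / real n * t * X 0 \<omega>) - 1) - \<i> * y =
              of_nat n * (iexp (y / n) - (\<Sum>k\<le>1. (\<i> * (y / n)) ^ k / fact k))"
            using n by (simp add: y_def field_simps)
          have "cmod (iexp (y / n) - (\<Sum>k\<le>1. (\<i> * (y / n)) ^ k / fact k)) \<le> (y / n)\<^sup>2 / 2"
            using iexp_approx1[of "y / n" 1] by (simp add: power2_eq_square fact_numeral)
          then have "real n * cmod (iexp (y / n) - (\<Sum>k\<le>1. (\<i> * (y / n)) ^ k / fact k)) \<le> real n * ((y / n)\<^sup>2 / 2)"
            by (intro mult_left_mono) auto
          also have "\<dots> = y\<^sup>2 / 2 / real n" using n by (simp add: power2_eq_square)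
          finally show "cmod (of_nat n * (iexp (1 / real n * t * X 0 \<omega>) - 1) - \<i> * y) \<le> y\<^sup>2 / 2 / real n"
            unfolding eq norm_mult norm_of_nat .
        qed
        show "(\<lambda>n. y\<^sup>2 / 2 / real n) \<longlonglongrightarrow> 0"
          by (rule real_tendsto_divide_at_top[OF tendsto_const filterlim_real_sequentially])
      qed
      then show "(\<lambda>n. of_nat n * (iexp (1 / real n * t * X 0 \<omega>) - 1)) \<longlonglongrightarrow> \<i> * (t * X 0 \<omega>)"
        by (simp add: y_def Lim_null[symmetric])
    qed
  qed simp_all
  have char: "(CLINT \<omega>|M. of_nat n * (iexp (1 / real n * t * X 0 \<omega>) - 1)) =
      of_nat n * (char (distr M borel (X 0)) (1 / real n * t) - 1)" for n
  proof -
    have "integrable M (\<lambda>\<omega>. iexp (1 / real n * t * X 0 \<omega>))"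
      by (rule integrable_const_bound[of _ 1]) auto
    then have "(CLINT \<omega>|M. iexp (1 / real n * t * X 0 \<omega>) - 1) = (CLINT \<omega>|M. iexp (1 / real n * t * X 0 \<omega>)) - 1"
      by (subst Bochner_Integration.integral_diff) (auto simp: prob_space)
    moreover have "char (distr M borel (X 0)) (1 / real n * t) = (CLINT \<omega>|M. iexp (1 / real n * t * X 0 \<omega>))"
      unfolding char_def by (subst integral_distr) auto
    ultimately show ?thesis by (simp only: integral_mult_right_zero)
  qed
  have mean: "(CLINT \<omega>|M. \<i> * (t * X 0 \<omega>)) = \<i> * (t * expectation (X 0))"
    using int by (simp del: of_real_mult add: integral_complex_of_real)
  \<comment> \<open>A constant limit needs no compensation, so the general power lemma is applied
    with w = 0.\<close>
  have "(\<lambda>n. of_nat n * (char (distr M borel (X 0)) (1 / real n * t) - 1) - \<i> * (0 :: real))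
      \<longlonglongrightarrow> \<i> * (t * expectation (X 0))"
    using lim unfolding char mean by simp
  from power_tendsto_exp_of_centered[OF \<mu>.cmod_char_le_1 this]
  have "(\<lambda>n. char (distr M borel (X 0)) (1 / real n * t) ^ n) \<longlonglongrightarrow> iexp (t * expectation (X 0))"
    by simp
  then show "(\<lambda>n. char (distr M borel (\<lambda>\<omega>. 1 / real n * (\<Sum>i<n. X i \<omega>))) t) \<longlonglongrightarrow> char (return borel (expectation (X 0))) t"
    using char_iid_affine_sum[OF assms(1), of "1 / real n" n 0 t for n] by (simp add: char_return)
qed

section \<open>Samples with a given density\<close>

lemma distributed_integrable:
  assumes "prob_space M" "distributed M lborel X (\<lambda>t. ennreal (f t))"
    and "f \<in> borel_measurable borel" "\<And>t. 0 \<le> f t"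
  shows "integrable lborel f"
proof (rule integrableI_nonneg)
  interpret prob_space M by fact
  have "(\<integral>\<^sup>+t. ennreal (f t) \<partial>lborel) = emeasure M (space M)"
    using distributed_emeasure[OF assms(2), of UNIV] by simp
  then show "(\<integral>\<^sup>+t. ennreal (f t) \<partial>lborel) < \<infinity>"
    by (simp add: emeasure_space_1)
qed (use assms in auto)

locale recip_sample = prob_space M + power_density f c \<beta>
  for M :: "'a measure" and f :: "real \<Rightarrow> real" and c \<beta> :: real +
  fixes x :: "nat \<Rightarrow> 'a \<Rightarrow> real"
  assumes iid: "iid M x"
    and range: "\<And>i \<omega>. \<omega> \<in> space M \<Longrightarrow> x i \<omega> \<in> {0..1}"
    and density: "distributed M lborel (x 0) (\<lambda>t. ennreal (f t))"
begin

lemmas x_measurable[measurable] = iidD(3)[OF iid]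

lemma distr_x: "distr M lborel (x 0) = density lborel (\<lambda>t. ennreal (f t))"
  by (rule distributed_distr_eq_density[OF density])

text \<open>A law with a density has no atom at 0. This discards the sample points where the
  reciprocal takes the conventional value 1 / 0 = 0.\<close>

lemma AE_x_pos: "AE \<omega> in M. 0 < x 0 \<omega> \<and> x 0 \<omega> \<le> 1"
proof -
  have "AE t in distr M lborel (x 0). t \<noteq> 0"
    unfolding distr_x using AE_lborel_singleton[of 0] by (subst AE_density) auto
  then have "AE \<omega> in M. x 0 \<omega> \<noteq> 0"
    by (rule AE_distrD[rotated]) simp
  then show ?thesis
    using AE_space by eventually_elim (use range[of _ 0] in force)
qed

lemma expectation_eq:
  fixes g :: "real \<Rightarrow> 'b :: {banach, second_countable_topology}"
  assumes [measurable]: "g \<in> borel_measurable borel" "S \<in> sets borel" and "AE \<omega> in M. x 0 \<omega> \<in> S"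
  shows "expectation (\<lambda>\<omega>. g (x 0 \<omega>)) = (LINT t:S|lborel. f t *\<^sub>R g t)"
proof -
  have "expectation (\<lambda>\<omega>. g (x 0 \<omega>)) = expectation (\<lambda>\<omega>. indicator S (x 0 \<omega>) *\<^sub>R g (x 0 \<omega>))"
    by (rule integral_cong_AE) (use assms(3) in \<open>auto simp: indicator_def\<close>)
  also have "\<dots> = (\<integral>t. indicator S t *\<^sub>R g t \<partial>distr M lborel (x 0))"
    by (subst integral_distr) auto
  also have "\<dots> = (\<integral>t. f t *\<^sub>R indicator S t *\<^sub>R g t \<partial>lborel)"
    unfolding distr_x by (subst integral_density) (auto simp: f_nonneg)
  also have "\<dots> = (LINT t:S|lborel. f t *\<^sub>R g t)"
    unfolding set_lebesgue_integral_def by (intro Bochner_Integration.integral_cong) (auto simp: mult.commute)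
  finally show ?thesis .
qed

lemma expectation_scaling_limit:
  fixes h :: "real \<Rightarrow> 'b :: {banach, second_countable_topology}"
  assumes [measurable]: "h \<in> borel_measurable borel"
    and "1 + \<beta> < k" "\<And>u. 0 < u \<Longrightarrow> norm (h u) \<le> A" "\<And>u. 0 < u \<Longrightarrow> norm (h u) \<le> A * u powr - k"
  shows "(\<lambda>n. real n *\<^sub>R expectation (\<lambda>\<omega>. h (scale n * x 0 \<omega>))) \<longlonglongrightarrow>
    c *\<^sub>R (LINT u:{0<..}|lborel. u powr \<beta> *\<^sub>R h u)"
proof -
  have "expectation (\<lambda>\<omega>. h (scale n * x 0 \<omega>)) = (LINT t:{0<..}|lborel. f t *\<^sub>R h (scale n * t))" for n
    by (rule expectation_eq) (use AE_x_pos in auto)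
  then show ?thesis using scaling_limit[OF assms] by simp
qed

lemma iid_recip: "iid M (\<lambda>i \<omega>. 1 / x i \<omega>)"
  by (rule iid_compose[OF iid]) simp

definition recip_law :: "real measure" where
  "recip_law = distr M borel (\<lambda>\<omega>. 1 / x 0 \<omega>)"

lemma char_recip_law: "char recip_law t = expectation (\<lambda>\<omega>. iexp (t * (1 / x 0 \<omega>)))"
  unfolding char_def recip_law_def by (subst integral_distr) auto

text \<open>By \<open>rel\<close>, \<open>w n\<close> is the centering built into the compensated
  integrand \<open>h\<close>, while \<open>b n\<close> is the centering actually wanted; their
  asymptotic difference l only shifts the limit law. The bounds on \<open>h\<close> are uniform for
  |t| \<le> B so that one majorant serves a whole sequence of t tending to 0, which proves
  continuity of the limit at 0.\<close>

theorem limit_law_exists: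
  fixes h :: "real \<Rightarrow> real \<Rightarrow> complex" and A :: "real \<Rightarrow> real"
  assumes [measurable]: "\<And>t. h t \<in> borel_measurable borel"
    and k: "1 + \<beta> < k"
    and h_le: "\<And>B t u. \<bar>t\<bar> \<le> B \<Longrightarrow> 0 < u \<Longrightarrow> cmod (h t u) \<le> A B"
    and h_decay: "\<And>B t u. \<bar>t\<bar> \<le> B \<Longrightarrow> 0 < u \<Longrightarrow> cmod (h t u) \<le> A B * u powr - k"
    and h_cont: "\<And>u. 0 < u \<Longrightarrow> isCont (\<lambda>t. h t u) 0"
    and rel: "\<And>n t. of_nat n * (char recip_law (1 / scale n * t) - 1) - \<i> * (t * w n) =
      real n *\<^sub>R expectation (\<lambda>\<omega>. h t (scale n * x 0 \<omega>))"
    and w: "(\<lambda>n. (w n)\<^sup>2 / n) \<longlonglongrightarrow> 0"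
    and b: "(\<lambda>n. b n - w n) \<longlonglongrightarrow> l"
  shows "\<exists>G. real_distribution G \<and>
    weak_conv_m (\<lambda>n. distr M borel (\<lambda>\<omega>. 1 / scale n * (\<Sum>i<n. 1 / x i \<omega>) - b n)) G \<and>
    char G = (\<lambda>t. exp (c *\<^sub>R (LINT u:{0<..}|lborel. u powr \<beta> *\<^sub>R h t u) - \<i> * (t * l)))"
proof -
  interpret \<mu>: real_distribution recip_law
    unfolding recip_law_def by (rule real_distribution_distr) simp
  define \<psi> where "\<psi> t = (LINT u:{0<..}|lborel. u powr \<beta> *\<^sub>R h t u)" for t
  have lim: "(\<lambda>n. char (distr M borel (\<lambda>\<omega>. 1 / scale n * (\<Sum>i<n. 1 / x i \<omega>) - b n)) t) \<longlonglongrightarrow>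
    exp (c *\<^sub>R \<psi> t - \<i> * (t * l))" for t
  proof -
    have "(\<lambda>n. real n *\<^sub>R expectation (\<lambda>\<omega>. h t (scale n * x 0 \<omega>))) \<longlonglongrightarrow> c *\<^sub>R \<psi> t"
      unfolding \<psi>_def
      by (rule expectation_scaling_limit[OF _ k h_le[OF order_refl] h_decay[OF order_refl]]) simp_all
    then have "(\<lambda>n. of_nat n * (char recip_law (1 / scale n * t) - 1) - \<i> * (t * w n)) \<longlonglongrightarrow> c *\<^sub>R \<psi> t"
      unfolding rel .
    moreover have "(\<lambda>n. (t * w n)\<^sup>2 / n) \<longlonglongrightarrow> 0"
      using tendsto_mult_left[OF w, of "t\<^sup>2"] by (simp add: power_mult_distrib)
    ultimately have "(\<lambda>n. char recip_law (1 / scale n * t) ^ n * exp (- \<i> * (t * w n))) \<longlonglongrightarrow> exp (c *\<^sub>R \<psi> t)"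
      by (intro power_tendsto_exp_of_centered \<mu>.cmod_char_le_1) auto
    moreover have "(\<lambda>n. exp (- \<i> * (t * (b n - w n)))) \<longlonglongrightarrow> exp (- \<i> * (t * l))"
      by (intro tendsto_intros b)
    ultimately have "(\<lambda>n. char recip_law (1 / scale n * t) ^ n * exp (- \<i> * (t * w n)) * exp (- \<i> * (t * (b n - w n))))
      \<longlonglongrightarrow> exp (c *\<^sub>R \<psi> t) * exp (- \<i> * (t * l))"
      by (rule tendsto_mult)
    \<comment> \<open>The two phases combine: \<open>w n\<close> cancels and the centering by
      \<open>b n\<close> is left.\<close>
    moreover have "char recip_law (1 / scale n * t) ^ n * exp (- \<i> * (t * w n)) * exp (- \<i> * (t * (b n - w n))) =
      char (distr M borel (\<lambda>\<omega>. 1 / scale n * (\<Sum>i<n. 1 / x i \<omega>) - b n)) t" for n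
      unfolding char_iid_affine_sum[OF iid_recip] recip_law_def mult.assoc mult_exp_exp
      by (simp add: algebra_simps)
    moreover have "exp (c *\<^sub>R \<psi> t) * exp (- \<i> * (t * l)) = exp (c *\<^sub>R \<psi> t - \<i> * (t * l))"
      unfolding mult_exp_exp by simp
    ultimately show ?thesis by simp
  qed
  have "isCont \<psi> 0"
    unfolding continuous_at_sequentially comp_def
  proof (intro allI impI)
    fix s :: "nat \<Rightarrow> real" assume s: "s \<longlonglongrightarrow> 0"
    from convergent_imp_Bseq[OF convergentI[OF s]] obtain B where B: "0 < B" "\<And>n. \<bar>s n\<bar> \<le> B"
      by (auto elim: BseqE)
    show "(\<lambda>n. \<psi> (s n)) \<longlonglongrightarrow> \<psi> 0"
      unfolding \<psi>_def set_lebesgue_integral_def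
    proof (rule integral_dominated_convergence)
      show "integrable lborel (\<lambda>u. A B * (indicator {0<..} u *\<^sub>R (u powr \<beta> * min 1 (u powr - k))))"
        using set_integrable_powr_min[OF \<beta> k] unfolding set_integrable_def by simp
      show "AE u in lborel. cmod (indicat_real {0<..} u *\<^sub>R u powr \<beta> *\<^sub>R h (s n) u) \<le>
          A B * (indicator {0<..} u *\<^sub>R (u powr \<beta> * min 1 (u powr - k)))" for n
      proof (rule AE_I2)
        fix u :: real
        show "cmod (indicat_real {0<..} u *\<^sub>R u powr \<beta> *\<^sub>R h (s n) u) \<le>
          A B * (indicator {0<..} u *\<^sub>R (u powr \<beta> * min 1 (u powr - k)))"
        proof (cases "0 < u")
          case True
          have "cmod (h (s n) u) \<le> A B * min 1 (u powr - k)"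
            using h_le[OF B(2) True] h_decay[OF B(2) True] by (auto simp: min_def)
          then have "u powr \<beta> * cmod (h (s n) u) \<le> u powr \<beta> * (A B * min 1 (u powr - k))"
            by (intro mult_left_mono) auto
          then show ?thesis using True by (simp add: mult_ac)
        qed simp
      qed
      show "AE u in lborel. (\<lambda>n. indicat_real {0<..} u *\<^sub>R u powr \<beta> *\<^sub>R h (s n) u) \<longlonglongrightarrow>
          indicat_real {0<..} u *\<^sub>R u powr \<beta> *\<^sub>R h 0 u"
      proof (rule AE_I2)
        fix u :: real
        show "(\<lambda>n. indicat_real {0<..} u *\<^sub>R u powr \<beta> *\<^sub>R h (s n) u) \<longlonglongrightarrow>
          indicat_real {0<..} u *\<^sub>R u powr \<beta> *\<^sub>R h 0 u"
          using isCont_tendsto_compose[OF h_cont s, of u]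
          by (cases "0 < u") (auto intro!: tendsto_intros)
      qed
    qed simp_all
  qed
  then have "isCont (\<lambda>t. exp (c *\<^sub>R \<psi> t - \<i> * (t * l))) 0"
    by (intro continuous_intros)
  from levy_continuity_exists[OF real_distribution_distr lim this]
  show ?thesis unfolding \<psi>_def by auto
qed

lemma integrable_iexp_recip: "integrable M (\<lambda>\<omega>. iexp (t * (1 / x 0 \<omega>)))"
  by (rule integrable_const_bound[of _ 1]) auto

end

section \<open>Negative and positive exponents\<close>

lemma iexp_recip_bounds:
  fixes t u B :: real
  assumes "\<bar>t\<bar> \<le> B" "0 < u"
  shows "cmod (iexp (t * (1 / u)) - 1) \<le> 2" "cmod (iexp (t * (1 / u)) - 1) \<le> B * u powr - 1"
proof -
  show "cmod (iexp (t * (1 / u)) - 1) \<le> 2"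
    by (rule order_trans[OF norm_triangle_ineq4]) simp
  have "cmod (iexp (t * (1 / u)) - 1) \<le> \<bar>t * (1 / u)\<bar>"
    using iexp_approx1[of "t * (1 / u)" 0] by simp
  also have "\<dots> \<le> B * u powr - 1"
    using assms by (simp add: abs_mult powr_minus_divide divide_right_mono)
  finally show "cmod (iexp (t * (1 / u)) - 1) \<le> B * u powr - 1" .
qed

lemma stable_law_of_limit:
  assumes "iid M X" "0 < \<alpha>" "\<alpha> \<le> 2" "real_distribution G" "\<And>a. G \<noteq> return borel a"
    and conv: "weak_conv_m (\<lambda>n. distr M borel (\<lambda>\<omega>. real n powr (- 1 / \<alpha>) * (\<Sum>i<n. X i \<omega>) - b n)) G"
  shows "stable_law \<alpha> G"
proof -
  from iid_realisation[OF assms(1)] obtain M' :: "(nat \<Rightarrow> real) measure" and X'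
    where "iid M' X'" and eq: "\<And>n a b. distr M' borel (\<lambda>\<omega>. a * (\<Sum>i<n. X' i \<omega>) - b) =
             distr M borel (\<lambda>\<omega>. a * (\<Sum>i<n. X i \<omega>) - b)"
    by blast
  then show ?thesis
    unfolding stable_law_def using assms conv[folded eq] by blast
qed

context recip_sample
begin

theorem stable_limit_of_neg_exponent:
  assumes neg: "\<beta> < 0"
  shows "\<exists>G. stable_law (1 + \<beta>) G \<and>
    weak_conv_m (\<lambda>n. distr M borel (\<lambda>\<omega>. real n powr (1 - 1 / (1 + \<beta>)) * mean_recip x n \<omega>)) G"
proof -
  define h :: "real \<Rightarrow> real \<Rightarrow> complex" where "h t u = iexp (t * (1 / u)) - 1" for t u
  have [measurable]: "h t \<in> borel_measurable borel" for t
    unfolding h_def by measurable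
  \<comment> \<open>The constant 2 + B majorises both the trivial bound 2 and the Lipschitz bound B
    / u.\<close>
  have bound: "cmod (h t u) \<le> 2 + B" "cmod (h t u) \<le> (2 + B) * u powr - 1" if "\<bar>t\<bar> \<le> B" "0 < u" for t u B
  proof -
    have "0 \<le> B" using that by linarith
    then show "cmod (h t u) \<le> 2 + B" using iexp_recip_bounds(1)[OF that] by (simp add: h_def)
    have "B * u powr - 1 \<le> (2 + B) * u powr - 1" by (intro mult_right_mono) auto
    then show "cmod (h t u) \<le> (2 + B) * u powr - 1" using iexp_recip_bounds(2)[OF that] by (simp add: h_def)
  qed
  have rel: "of_nat n * (char recip_law (1 / scale n * t) - 1) - \<i> * (t * 0) =
      real n *\<^sub>R expectation (\<lambda>\<omega>. h t (scale n * x 0 \<omega>))" for n t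
  proof -
    have "expectation (\<lambda>\<omega>. h t (scale n * x 0 \<omega>)) = expectation (\<lambda>\<omega>. iexp (1 / scale n * t * (1 / x 0 \<omega>)) - 1)"
      by (simp add: h_def)
    also have "\<dots> = char recip_law (1 / scale n * t) - 1"
      unfolding char_recip_law
      by (subst Bochner_Integration.integral_diff[OF integrable_iexp_recip]) (auto simp: prob_space)
    finally show ?thesis by (simp add: scaleR_conv_of_real)
  qed
  have "\<exists>G. real_distribution G \<and>
    weak_conv_m (\<lambda>n. distr M borel (\<lambda>\<omega>. 1 / scale n * (\<Sum>i<n. 1 / x i \<omega>) - 0)) G \<and>
    char G = (\<lambda>t. exp (c *\<^sub>R (LINT u:{0<..}|lborel. u powr \<beta> *\<^sub>R h t u) - \<i> * (t * 0)))"
  proof (rule limit_law_exists[where k = 1 and A = "\<lambda>B. 2 + B" and w = "\<lambda>_. 0"])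
    show "isCont (\<lambda>t. h t u) 0" for u
      unfolding h_def by (intro continuous_intros)
  qed (use bound rel neg in auto)
  then obtain G where G: "real_distribution G"
    "weak_conv_m (\<lambda>n. distr M borel (\<lambda>\<omega>. 1 / scale n * (\<Sum>i<n. 1 / x i \<omega>) - 0)) G"
    "char G = (\<lambda>t. exp (c *\<^sub>R (LINT u:{0<..}|lborel. u powr \<beta> *\<^sub>R h t u) - \<i> * (t * 0)))"
    by blast
  have int: "integrable lborel (\<lambda>u. indicat_real {0<..} u *\<^sub>R (u powr \<beta> *\<^sub>R h 1 u))"
    using scaling_limit_integrable[of "h 1" 1, OF _ _ bound(1)[of 1 1] bound(2)[of 1 1]] neg
    unfolding set_integrable_def by simp
  \<comment> \<open>Minus the real part of the integrand of the exponent at t = 1. A positive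
    integral of \<open>R\<close> makes the modulus of \<open>char G 1\<close> less than 1, whereas a
    point mass has a characteristic function of modulus 1.\<close>
  define R where "R u = indicat_real {0<..} u * (u powr \<beta> * (1 - cos (1 / u)))" for u
  have R: "R u = - Re (indicat_real {0<..} u *\<^sub>R (u powr \<beta> *\<^sub>R h 1 u))" for u
    by (simp add: R_def h_def Re_exp algebra_simps)
  have R_int: "integrable lborel R"
    unfolding R using int by (intro integrable_minus integrable_Re)
  have R_nonneg: "0 \<le> R u" for u by (simp add: R_def)
  have "0 < (\<integral>u. R u \<partial>lborel)"
  proof (rule ccontr)
    assume "\<not> 0 < (\<integral>u. R u \<partial>lborel)"
    moreover have "0 \<le> (\<integral>u. R u \<partial>lborel)" using R_nonneg by simp
    ultimately have "(\<integral>u. R u \<partial>lborel) = 0" by linarith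
    then have "AE u in lborel. R u = 0"
      using integral_nonneg_eq_0_iff_AE[OF R_int] R_nonneg by simp
    then have "AE u :: real in lborel. u \<notin> {1..2}"
    proof eventually_elim
      case (elim u)
      \<comment> \<open>On [1, 2] the argument 1 / u stays in (0, 1], below pi, so \<open>R\<close>
        is strictly positive on a set of positive measure.\<close>
      have "cos (1 / u) < 1" if "1 \<le> u"
      proof -
        have "1 / u \<le> 1" "0 < 1 / u" using that by auto
        then show ?thesis using cos_monotone_0_pi[of 0 "1 / u"] pi_gt3 by simp
      qed
      then show ?case using elim by (auto simp: R_def)
    qed
    then have "emeasure lborel {1..2 :: real} = 0"
      by (subst (asm) AE_iff_measurable[of "{1..2}"]) auto
    then show False by simp
  qed
  moreover have "Re (LINT u:{0<..}|lborel. u powr \<beta> *\<^sub>R h 1 u) = - (\<integral>u. R u \<partial>lborel)"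
    unfolding R set_lebesgue_integral_def using int by (subst integral_Re[symmetric]) auto
  ultimately have "cmod (char G 1) < 1"
    unfolding G(3) using c_pos by (simp add: mult_pos_pos)
  then have nondeg: "G \<noteq> return borel a" for a
    by (auto simp: char_return)
  have scale: "real n powr (- 1 / (1 + \<beta>)) = 1 / scale n" for n
    using powr_minus_divide[of "real n" "1 / (1 + \<beta>)"] by (simp add: scale_def)
  have "stable_law (1 + \<beta>) G"
    by (rule stable_law_of_limit[OF iid_recip _ _ G(1) nondeg G(2)[folded scale]])
      (use \<beta> neg in auto)
  \<comment> \<open>The factor 1 / n in the mean turns n powr (1 - 1 / (1 + \<beta>)) into 1 /
    \<open>scale n\<close>; for n = 0 both sides are 0 by convention.\<close>
  moreover have "real n powr (1 - 1 / (1 + \<beta>)) * mean_recip x n \<omega> = 1 / scale n * (\<Sum>i<n. 1 / x i \<omega>) - 0" for n \<omega>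
    by (cases "n = 0") (simp_all add: mean_recip_def scale_def powr_diff)
  ultimately show ?thesis using G(2) by auto
qed

text \<open>Near 0 the function f t / t is at most 2 c t powr (\<beta> - 1), integrable since
  \<beta> > 0; beyond \<delta> it is at most f t / \<delta>. So the mean of the reciprocal is
  finite.\<close>

theorem weak_law_of_pos_exponent:
  assumes pos: "\<beta> > 0"
  shows "integrable M (\<lambda>\<omega>. 1 / x 0 \<omega>)"
    and "weak_conv_m (\<lambda>n. distr M borel (mean_recip x n)) (return borel (\<integral>\<omega>. 1 / x 0 \<omega> \<partial>M))"
proof -
  obtain \<delta> where \<delta>: "0 < \<delta>" "\<And>t. 0 < t \<Longrightarrow> t < \<delta> \<Longrightarrow> f t \<le> 2 * c * t powr \<beta>"
    using near_zero_bound by blast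
  have near: "set_integrable lborel {0..\<delta>} (\<lambda>t. t powr (\<beta> - 1))"
    by (rule set_integrable_lborel_of_nonneg)
      (use \<delta> pos integrable_on_powr_from_0[of "\<beta> - 1" \<delta>] in auto)
  have "integrable lborel (\<lambda>t. f t *\<^sub>R (indicator {0<..} t *\<^sub>R (1 / t)))"
  proof (rule Bochner_Integration.integrable_bound)
    show "integrable lborel (\<lambda>t. 2 * c * (indicat_real {0..\<delta>} t *\<^sub>R t powr (\<beta> - 1)) + f t * (1 / \<delta>))"
      using near f_integrable unfolding set_integrable_def by simp
    show "AE t in lborel. norm (f t *\<^sub>R (indicator {0<..} t *\<^sub>R (1 / t))) \<le>
      norm (2 * c * (indicat_real {0..\<delta>} t *\<^sub>R t powr (\<beta> - 1)) + f t * (1 / \<delta>))"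
    proof (rule AE_I2)
      fix t :: real
      have nonneg: "0 \<le> 2 * c * (indicat_real {0..\<delta>} t *\<^sub>R t powr (\<beta> - 1))" "0 \<le> f t * (1 / \<delta>)"
        using c_pos \<delta> f_nonneg[of t] by auto
      consider "t \<le> 0" | "0 < t" "t < \<delta>" | "\<delta> \<le> t" by linarith
      then have "f t *\<^sub>R (indicator {0<..} t *\<^sub>R (1 / t)) \<le>
        2 * c * (indicat_real {0..\<delta>} t *\<^sub>R t powr (\<beta> - 1)) + f t * (1 / \<delta>)"
      proof cases
        case 2
        have "f t * (1 / t) \<le> 2 * c * t powr \<beta> * (1 / t)"
          using \<delta> 2 by (intro mult_right_mono) auto
        also have "\<dots> = 2 * c * t powr (\<beta> - 1)" using 2 by (simp add: powr_diff)
        finally show ?thesis using 2 nonneg by simp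
      next
        case 3
        have "f t * (1 / t) \<le> f t * (1 / \<delta>)"
          using 3 \<delta> f_nonneg by (intro mult_left_mono) (auto simp: field_simps)
        then show ?thesis using 3 nonneg \<delta> by simp
      qed (use nonneg in simp)
      moreover have "0 \<le> f t *\<^sub>R (indicator {0<..} t *\<^sub>R (1 / t))"
        using f_nonneg by (simp add: indicator_def)
      ultimately show "norm (f t *\<^sub>R (indicator {0<..} t *\<^sub>R (1 / t))) \<le>
        norm (2 * c * (indicat_real {0..\<delta>} t *\<^sub>R t powr (\<beta> - 1)) + f t * (1 / \<delta>))"
        by simp
    qed
  qed simp
  then have "integrable (distr M lborel (x 0)) (\<lambda>t. indicat_real {0<..} t *\<^sub>R (1 / t))"
    unfolding distr_x by (subst integrable_density) (auto simp: f_nonneg)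
  then have "integrable M (\<lambda>\<omega>. indicat_real {0<..} (x 0 \<omega>) *\<^sub>R (1 / x 0 \<omega>))"
    by (subst (asm) integrable_distr_eq) auto
  then show int: "integrable M (\<lambda>\<omega>. 1 / x 0 \<omega>)"
    by (rule integrable_cong_AE_imp) (use AE_x_pos in auto)
  show "weak_conv_m (\<lambda>n. distr M borel (mean_recip x n)) (return borel (\<integral>\<omega>. 1 / x 0 \<omega> \<partial>M))"
    using iid_weak_law[OF iid_recip int] by (simp add: mean_recip_def[abs_def])
qed

end

section \<open>The logarithmic case\<close>

lemma trunc_above_scaled: "0 < a \<Longrightarrow> trunc_above (a * y) z / a = trunc_above y (z / a)"
  by (simp add: trunc_above_def divide_le_eq mult.commute)

lemma trunc_above_bounds:
  assumes "0 \<le> z" "0 \<le> t"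
  shows "0 \<le> trunc_above t z" "trunc_above t z \<le> t" "trunc_above t z \<le> z"
  using assms by (auto simp: trunc_above_def)

lemma set_integral_recip:
  fixes a b :: real
  assumes "0 < a" "a \<le> b"
  shows "set_integrable lborel {a..b} (\<lambda>u. 1 / u)" "(LINT u:{a..b}|lborel. 1 / u) = ln (b / a)"
    and "set_integrable lborel {a..<b} (\<lambda>u. 1 / u)" "(LINT u:{a..<b}|lborel. 1 / u) = ln (b / a)"
proof -
  have "has_bochner_integral lborel (\<lambda>u. 1 / u * indicator {a..b} u) (ln b - ln a)"
    by (rule has_bochner_integral_FTC_Icc_real[where F = ln and f = "\<lambda>u. 1 / u"])
      (use assms in \<open>auto intro!: derivative_eq_intros continuous_intros\<close>)
  then have closed: "has_bochner_integral lborel (\<lambda>u. indicator {a..b} u *\<^sub>R (1 / u)) (ln b - ln a)"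
    by (simp add: mult.commute)
  also have "?this \<longleftrightarrow> has_bochner_integral lborel (\<lambda>u. indicator {a..<b} u *\<^sub>R (1 / u)) (ln b - ln a)"
    by (rule has_bochner_integral_cong_AE)
      (use AE_lborel_singleton[of b] in \<open>auto simp: indicator_def elim!: eventually_mono\<close>)
  finally show "set_integrable lborel {a..<b} (\<lambda>u. 1 / u)" "(LINT u:{a..<b}|lborel. 1 / u) = ln (b / a)"
    unfolding set_integrable_def set_lebesgue_integral_def
    using assms by (auto simp: has_bochner_integral_iff ln_div)
  show "set_integrable lborel {a..b} (\<lambda>u. 1 / u)" "(LINT u:{a..b}|lborel. 1 / u) = ln (b / a)"
    using closed assms unfolding set_integrable_def set_lebesgue_integral_def
    by (auto simp: has_bochner_integral_iff ln_div)
qed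

lemma set_integral_recip_square:
  assumes "0 < (a :: real)"
  shows "(LINT u:{a..}|lborel. (1 / u)\<^sup>2) = 1 / a"
proof -
  have "(\<integral>\<^sup>+u. ennreal ((1 / u)\<^sup>2) * indicator {a..} u \<partial>lborel) = ennreal (0 - (- 1 / a))"
  proof (rule nn_integral_FTC_atLeast)
    show "((\<lambda>u :: real. - 1 / u) \<longlongrightarrow> 0) at_top" by real_asymp
  qed (use assms in \<open>auto intro!: derivative_eq_intros simp: power2_eq_square\<close>)
  also have "(\<integral>\<^sup>+u. ennreal ((1 / u)\<^sup>2) * indicator {a..} u \<partial>lborel) =
      (\<integral>\<^sup>+u. ennreal (indicator {a..} u *\<^sub>R (1 / u)\<^sup>2) \<partial>lborel)"
    by (intro nn_integral_cong) (auto simp: indicator_def)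
  finally have "(\<integral>\<^sup>+u. ennreal (indicator {a..} u *\<^sub>R (1 / u)\<^sup>2) \<partial>lborel) = ennreal (1 / a)"
    by simp
  then show ?thesis
    unfolding set_lebesgue_integral_def using assms
    by (subst integral_eq_nn_integral) (auto simp: enn2real_ennreal)
qed

text \<open>The restriction to positive u is essential: 0 powr 0 is 0, not 1.\<close>

lemma powr_zero_integral:
  "(LINT u:{0<..}|lborel. u powr 0 *\<^sub>R (h u :: 'b :: {banach, second_countable_topology})) = (LINT u:{0<..}|lborel. h u)"
  by (rule set_lebesgue_integral_cong) auto

lemma inverse_square_le:
  fixes u k :: real
  assumes "0 < u" "u \<le> k"
  shows "1 \<le> k\<^sup>2 * u powr - 2"
  using assms by (simp add: powr_minus_divide)

locale recip_sample_flat = recip_sample M f c 0 x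
  for M :: "'a measure" and f :: "real \<Rightarrow> real" and c :: real and x :: "nat \<Rightarrow> 'a \<Rightarrow> real"
begin

lemma scale_flat: "scale n = real n"
  by (simp add: scale_def)

lemma x_nonneg: "\<omega> \<in> space M \<Longrightarrow> 0 \<le> x i \<omega>"
  using range[of \<omega> i] by simp

lemma tail_limit:
  assumes "0 < y"
  shows "(\<lambda>n. real n * prob {\<omega> \<in> space M. real n * y < 1 / x 0 \<omega>}) \<longlonglongrightarrow> c / y"
proof -
  \<comment> \<open>After scaling by n the event n y < 1 / x becomes 0 < u < 1 / y. The bounded
    support gives decay of order 2.\<close>
  define h :: "real \<Rightarrow> real" where "h = indicator {0<..<1 / y}"
  have [measurable]: "h \<in> borel_measurable borel" by (simp add: h_def)
  have "(\<lambda>n. real n *\<^sub>R expectation (\<lambda>\<omega>. h (scale n * x 0 \<omega>))) \<longlonglongrightarrow>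
      c *\<^sub>R (LINT u:{0<..}|lborel. u powr 0 *\<^sub>R h u)"
  proof (rule expectation_scaling_limit[where k = 2 and A = "1 + (1 / y)\<^sup>2"])
    fix u :: real assume u: "0 < u"
    show "norm (h u) \<le> 1 + (1 / y)\<^sup>2" by (simp add: h_def indicator_def)
    have "1 \<le> (1 / y)\<^sup>2 * u powr - 2" if "u < 1 / y"
      using inverse_square_le[OF u, of "1 / y"] that by simp
    then have "norm (h u) \<le> (1 / y)\<^sup>2 * u powr - 2" using u by (simp add: h_def indicator_def)
    also have "\<dots> \<le> (1 + (1 / y)\<^sup>2) * u powr - 2" by (intro mult_right_mono) auto
    finally show "norm (h u) \<le> (1 + (1 / y)\<^sup>2) * u powr - 2" .
  qed simp_all
  also have "(LINT u:{0<..}|lborel. u powr 0 *\<^sub>R h u) = (LINT u|lborel. indicator {0<..<1 / y} u)"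
    unfolding powr_zero_integral unfolding set_lebesgue_integral_def h_def
    by (intro Bochner_Integration.integral_cong) (auto simp: indicator_def)
  also have "\<dots> = 1 / y" using assms by simp
  finally have lim: "(\<lambda>n. real n *\<^sub>R expectation (\<lambda>\<omega>. h (scale n * x 0 \<omega>))) \<longlonglongrightarrow> c / y" by simp
  have "real n *\<^sub>R expectation (\<lambda>\<omega>. h (scale n * x 0 \<omega>)) =
      real n * prob {\<omega> \<in> space M. real n * y < 1 / x 0 \<omega>}" for n
  proof (cases "n = 0")
    case False
    have "h (scale n * x 0 \<omega>) = indicator {\<omega> \<in> space M. real n * y < 1 / x 0 \<omega>} \<omega>" if "\<omega> \<in> space M" for \<omega>
    proof (cases "x 0 \<omega> = 0")
      case True
      \<comment> \<open>At x = 0 the conventions agree: 1 / 0 = 0 does not exceed n y, and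
        \<open>h\<close> vanishes at 0.\<close>
      have "0 \<le> real n * y" using assms by simp
      then show ?thesis using True by (simp add: h_def indicator_def)
    next
      case False
      then show ?thesis
        using x_nonneg[OF that, of 0] \<open>n \<noteq> 0\<close> assms that
        by (auto simp: h_def scale_flat indicator_def field_simps)
    qed
    then have "expectation (\<lambda>\<omega>. h (scale n * x 0 \<omega>)) =
        expectation (indicator {\<omega> \<in> space M. real n * y < 1 / x 0 \<omega>})"
      by (intro Bochner_Integration.integral_cong) auto
    then show ?thesis by simp
  qed simp
  then show ?thesis using lim by (simp only:)
qed

lemma trunc_recip: "trunc_above (real n * y) (1 / x i \<omega>) / real n = trunc_above y (1 / (scale n * x i \<omega>))" if "0 < n"
  using trunc_above_scaled[of "real n" y "1 / x i \<omega>"] that by (simp add: scale_flat mult.commute)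

lemma trunc_second_moment_limit:
  assumes "0 < y"
  shows "(\<lambda>n. real n * expectation (\<lambda>\<omega>. (trunc_above (real n * y) (1 / x 0 \<omega>) / real n)\<^sup>2)) \<longlonglongrightarrow> c * y"
proof -
  define h :: "real \<Rightarrow> real" where "h u = (trunc_above y (1 / u))\<^sup>2" for u
  have [measurable]: "h \<in> borel_measurable borel" unfolding h_def by measurable
  have "(\<lambda>n. real n *\<^sub>R expectation (\<lambda>\<omega>. h (scale n * x 0 \<omega>))) \<longlonglongrightarrow>
      c *\<^sub>R (LINT u:{0<..}|lborel. u powr 0 *\<^sub>R h u)"
  proof (rule expectation_scaling_limit[where k = 2 and A = "1 + y\<^sup>2"])
    fix u :: real assume u: "0 < u"
    note b = trunc_above_bounds[of "1 / u" y]
    have "h u \<le> y\<^sup>2" unfolding h_def using b u assms by (intro power_mono) auto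
    then show "norm (h u) \<le> 1 + y\<^sup>2" by (simp add: h_def)
    have "h u \<le> (1 / u)\<^sup>2" unfolding h_def using b u assms by (intro power_mono) auto
    then have "norm (h u) \<le> 1 * u powr - 2" using u by (simp add: h_def powr_minus_divide power_divide)
    also have "\<dots> \<le> (1 + y\<^sup>2) * u powr - 2" by (intro mult_right_mono) auto
    finally show "norm (h u) \<le> (1 + y\<^sup>2) * u powr - 2" .
  qed simp_all
  also have "(LINT u:{0<..}|lborel. u powr 0 *\<^sub>R h u) = (LINT u:{1 / y..}|lborel. (1 / u)\<^sup>2)"
    unfolding powr_zero_integral unfolding set_lebesgue_integral_def h_def
  proof (intro Bochner_Integration.integral_cong refl)
    fix u
    have "0 < 1 / y" using assms by simp
    show "indicat_real {0<..} u *\<^sub>R (trunc_above y (1 / u))\<^sup>2 = indicat_real {1 / y..} u *\<^sub>R (1 / u)\<^sup>2"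
    proof (cases "0 < u")
      case True
      then have "1 / u \<le> y \<longleftrightarrow> 1 / y \<le> u" using assms by (simp add: field_simps)
      then show ?thesis using True by (simp add: trunc_above_def indicator_def)
    next
      case False
      then have "\<not> 1 / y \<le> u" using \<open>0 < 1 / y\<close> by linarith
      then show ?thesis using False by simp
    qed
  qed
  also have "\<dots> = y" using set_integral_recip_square[of "1 / y"] assms by simp
  finally have lim: "(\<lambda>n. real n *\<^sub>R expectation (\<lambda>\<omega>. h (scale n * x 0 \<omega>))) \<longlonglongrightarrow> c * y" by simp
  have "real n *\<^sub>R expectation (\<lambda>\<omega>. h (scale n * x 0 \<omega>)) =
      real n * expectation (\<lambda>\<omega>. (trunc_above (real n * y) (1 / x 0 \<omega>) / real n)\<^sup>2)" for n
    by (cases "n = 0") (simp_all add: h_def trunc_recip)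
  then show ?thesis using lim by (simp only:)
qed

text \<open>The integral of f t / t over [1 / n, 1] in probabilistic form. After scaling,
  \<open>center n\<close> / n is the mean of \<open>trunc_above 1 (1 / u)\<close>, the
  compensator.\<close>

definition center :: "nat \<Rightarrow> real" where
  "center n = expectation (\<lambda>\<omega>. trunc_above (real n) (1 / x 0 \<omega>))"

lemma integrable_trunc: "0 \<le> t \<Longrightarrow> integrable M (\<lambda>\<omega>. trunc_above t (1 / (a * x 0 \<omega>)))" if "0 \<le> a"
  using trunc_above_bounds[of "1 / (a * x 0 _)" t] x_nonneg that
  by (intro integrable_const_bound[of _ t]) (auto intro!: AE_I2)

text \<open>Each truncated mean diverges logarithmically. The difference of two truncations is
  supported between 1 and 1 / y, where the scaling limit applies and the integral of 1 / u gives ln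
  y.\<close>

lemma trunc_mean_limit:
  assumes y: "0 < y"
  shows "(\<lambda>n. real n * expectation (\<lambda>\<omega>. trunc_above (real n * y) (1 / x 0 \<omega>) / real n) - center n) \<longlonglongrightarrow> c * ln y"
proof -
  define h :: "real \<Rightarrow> real" where "h u = trunc_above y (1 / u) - trunc_above 1 (1 / u)" for u
  have [measurable]: "h \<in> borel_measurable borel" unfolding h_def by measurable
  have "(\<lambda>n. real n *\<^sub>R expectation (\<lambda>\<omega>. h (scale n * x 0 \<omega>))) \<longlonglongrightarrow>
      c *\<^sub>R (LINT u:{0<..}|lborel. u powr 0 *\<^sub>R h u)"
  \<comment> \<open>The factor 1 + y bounds \<open>h\<close>, and 1 + 1 / y bounds its support,
    beyond which both truncations equal 1 / u and cancel.\<close>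
  proof (rule expectation_scaling_limit[where k = 2 and A = "(1 + y) * (1 + 1 / y)\<^sup>2"])
    fix u :: real assume u: "0 < u"
    have h: "norm (h u) \<le> 1 + y"
      using trunc_above_bounds[of "1 / u" y] trunc_above_bounds[of "1 / u" 1] u y unfolding h_def by auto
    have "1 \<le> (1 + 1 / y)\<^sup>2" using y by simp
    then have "(1 + y) * 1 \<le> (1 + y) * (1 + 1 / y)\<^sup>2" using y by (intro mult_left_mono) auto
    with h show "norm (h u) \<le> (1 + y) * (1 + 1 / y)\<^sup>2" by simp
    show "norm (h u) \<le> (1 + y) * (1 + 1 / y)\<^sup>2 * u powr - 2"
    proof (cases "u \<le> 1 + 1 / y")
      case True
      from inverse_square_le[OF u this] have "(1 + y) * 1 \<le> (1 + y) * ((1 + 1 / y)\<^sup>2 * u powr - 2)"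
        using y by (intro mult_left_mono) auto
      with h show ?thesis by simp
    next
      case False
      moreover have "0 < 1 / y" using y by simp
      ultimately have "1 < u" "1 / y < u" by linarith+
      then have "1 / u \<le> 1" "1 / u \<le> y" using y by (auto simp: field_simps)
      then show ?thesis using y by (simp add: h_def trunc_above_def)
    qed
  qed simp_all
  also have "(LINT u:{0<..}|lborel. u powr 0 *\<^sub>R h u) = ln y"
  proof (cases "1 \<le> y")
    case True
    then have "1 / y \<le> 1" "0 < 1 / y" by auto
    have "(LINT u:{0<..}|lborel. h u) = (LINT u:{1 / y..<1}|lborel. 1 / u)"
      unfolding set_lebesgue_integral_def
    proof (intro Bochner_Integration.integral_cong refl)
      fix u
      show "indicat_real {0<..} u *\<^sub>R h u = indicat_real {1 / y..<1} u *\<^sub>R (1 / u)"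
      proof (cases "0 < u")
        case u: True
        have "1 / u \<le> y \<longleftrightarrow> 1 / y \<le> u" "1 / u \<le> 1 \<longleftrightarrow> 1 \<le> u" using u y by (auto simp: field_simps)
        then show ?thesis using u \<open>1 / y \<le> 1\<close> by (auto simp: h_def trunc_above_def indicator_def)
      next
        case False
        then have "\<not> 1 / y \<le> u" using \<open>0 < 1 / y\<close> by linarith
        then show ?thesis using False by simp
      qed
    qed
    then show ?thesis unfolding powr_zero_integral
      using set_integral_recip(4)[of "1 / y" 1] \<open>1 / y \<le> 1\<close> \<open>0 < 1 / y\<close> by simp
  next
    case False
    then have "1 \<le> 1 / y" using y by simp
    have "(LINT u:{0<..}|lborel. h u) = (LINT u:{1..<1 / y}|lborel. - (1 / u))"
      unfolding set_lebesgue_integral_def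
    proof (intro Bochner_Integration.integral_cong refl)
      fix u
      show "indicat_real {0<..} u *\<^sub>R h u = indicat_real {1..<1 / y} u *\<^sub>R - (1 / u)"
      proof (cases "0 < u")
        case u: True
        have "1 / u \<le> y \<longleftrightarrow> 1 / y \<le> u" "1 / u \<le> 1 \<longleftrightarrow> 1 \<le> u" using u y by (auto simp: field_simps)
        then show ?thesis using u \<open>1 \<le> 1 / y\<close> by (auto simp: h_def trunc_above_def indicator_def)
      qed simp
    qed
    also have "\<dots> = - (LINT u:{1..<1 / y}|lborel. 1 / u)"
      using set_integral_recip(3)[of 1 "1 / y"] \<open>1 \<le> 1 / y\<close> by (intro set_integral_uminus) auto
    finally show ?thesis unfolding powr_zero_integral
      using set_integral_recip(4)[of 1 "1 / y"] \<open>1 \<le> 1 / y\<close> y by (simp add: ln_div)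
  qed
  finally have lim: "(\<lambda>n. real n *\<^sub>R expectation (\<lambda>\<omega>. h (scale n * x 0 \<omega>))) \<longlonglongrightarrow> c * ln y" by simp
  have "\<forall>\<^sub>F n in sequentially. real n *\<^sub>R expectation (\<lambda>\<omega>. h (scale n * x 0 \<omega>)) =
      real n * expectation (\<lambda>\<omega>. trunc_above (real n * y) (1 / x 0 \<omega>) / real n) - center n"
  proof (rule eventually_sequentiallyI[of 1])
    fix n :: nat assume "1 \<le> n"
    then have n: "0 < n" by simp
    have "center n = real n * expectation (\<lambda>\<omega>. trunc_above (real n * 1) (1 / x 0 \<omega>) / real n)"
      using n by (simp add: center_def)
    then show "real n *\<^sub>R expectation (\<lambda>\<omega>. h (scale n * x 0 \<omega>)) =
      real n * expectation (\<lambda>\<omega>. trunc_above (real n * y) (1 / x 0 \<omega>) / real n) - center n"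
      unfolding trunc_recip[OF n] h_def
      using integrable_trunc[of "scale n" y] integrable_trunc[of "scale n" 1] y
      by (simp add: scale_flat right_diff_distrib)
  qed
  then show ?thesis using lim by (rule Lim_transform_eventually[rotated])
qed

text \<open>The term c ln n is the integral of c / t over the same interval [1 / n, 1]. This links
  the exact centering with the improper integral in \<open>log_centering_condition\<close>.\<close>

lemma center_minus_ln:
  assumes "1 \<le> n"
  shows "center n - c * ln (real n) = (LINT t:{1 / real n..1}|lborel. (f t - c) / t)"
proof -
  define a where "a = 1 / real n"
  have a: "0 < a" "a \<le> 1" using assms by (auto simp: a_def)
  have "center n = (LINT t:{0<..1}|lborel. f t *\<^sub>R trunc_above (real n) (1 / t))"
    unfolding center_def by (rule expectation_eq) (use AE_x_pos in auto)
  also have "\<dots> = (LINT t:{a..1}|lborel. f t / t)"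
    unfolding set_lebesgue_integral_def
  proof (intro Bochner_Integration.integral_cong refl)
    fix t
    show "indicat_real {0<..1} t *\<^sub>R f t *\<^sub>R trunc_above (real n) (1 / t) = indicat_real {a..1} t *\<^sub>R (f t / t)"
    proof (cases "0 < t")
      case True
      then have "1 / t \<le> real n \<longleftrightarrow> a \<le> t" using assms by (simp add: a_def field_simps)
      then show ?thesis using True by (simp add: trunc_above_def indicator_def)
    qed (use a in simp)
  qed
  finally have center: "center n = (LINT t:{a..1}|lborel. f t / t)" .
  have int_f: "set_integrable lborel {a..1} (\<lambda>t. f t / t)"
    unfolding set_integrable_def
  proof (rule Bochner_Integration.integrable_bound[OF integrable_mult_left[OF f_integrable, of "1 / a"]])
    show "AE t in lborel. norm (indicat_real {a..1} t *\<^sub>R (f t / t)) \<le> norm (f t * (1 / a))"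
    proof (rule AE_I2)
      fix t :: real
      show "norm (indicat_real {a..1} t *\<^sub>R (f t / t)) \<le> norm (f t * (1 / a))"
        using a f_nonneg[of t] by (auto simp: indicator_def intro!: divide_left_mono)
    qed
  qed simp
  have val_c: "(LINT t:{a..1}|lborel. c * (1 / t)) = c * ln (1 / a)"
    unfolding real_scaleR_def[symmetric] set_integral_scaleR_right set_integral_recip(2)[OF a] ..
  have int_c: "set_integrable lborel {a..1} (\<lambda>t. c * (1 / t))"
    by (rule set_integrable_mult_right) (rule set_integral_recip(1)[OF a])
  have "(LINT t:{a..1}|lborel. f t / t - c * (1 / t)) = center n - c * ln (1 / a)"
    unfolding center val_c[symmetric] by (rule set_integral_diff(2)[OF int_f int_c])
  then show ?thesis
    using assms by (simp add: a_def[symmetric] diff_divide_distrib) (simp add: a_def)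
qed

lemma center_smallo: "(\<lambda>n. center n - c * ln (real n)) \<in> o(\<lambda>n. ln (real n))"
proof (rule landau_o.smallI)
  fix e :: real assume e: "0 < e"
  have "((\<lambda>t. f t / (c * t powr 0) * c - c) \<longlongrightarrow> 1 * c - c) (at_right 0)"
    by (intro tendsto_intros asymp)
  then have "\<forall>\<^sub>F t in at_right 0. \<bar>f t / (c * t powr 0) * c - c\<bar> < e / 2"
    using e tendstoD[of _ 0 "at_right 0" "e / 2"] by (fastforce simp: dist_real_def)
  then obtain \<delta> where \<delta>: "0 < \<delta>" "\<And>t. 0 < t \<Longrightarrow> t < \<delta> \<Longrightarrow> \<bar>f t / (c * t powr 0) * c - c\<bar> < e / 2"
    unfolding eventually_at_right_field by blast
  have near: "\<bar>f t - c\<bar> \<le> e / 2" if "0 < t" "t < \<delta>" for t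
    using \<delta>(2)[OF that] that c_pos by simp
  \<comment> \<open>Below \<delta> the density is within e / 2 of c, which costs at most (e / 2) ln
    n. Above \<delta> the weight 1 / t is at most 1 / \<delta>, which costs at most K independently
    of n.\<close>
  define K where "K = ((LINT t|lborel. f t) + c) / \<delta>"
  have bound: "\<bar>center n - c * ln (real n)\<bar> \<le> e / 2 * ln (real n) + K" if n: "1 \<le> n" for n
  proof -
    define a where "a = 1 / real n"
    have a: "0 < a" "a \<le> 1" using n by (auto simp: a_def)
    have int_1: "integrable lborel (\<lambda>t. indicat_real {a..1} t *\<^sub>R (1 / t))"
      using set_integral_recip(1)[OF a] unfolding set_integrable_def .
    have val_1: "(\<integral>t. indicat_real {a..1} t *\<^sub>R (1 / t) \<partial>lborel) = ln (real n)"
      using set_integral_recip(2)[OF a] unfolding set_lebesgue_integral_def by (simp add: a_def)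
    let ?w = "\<lambda>t. e / 2 * (indicat_real {a..1} t *\<^sub>R (1 / t)) + (f t + c * indicator {0..1} t) * (1 / \<delta>)"
    have int_w: "integrable lborel ?w"
      using int_1 f_integrable by (intro Bochner_Integration.integrable_add integrable_mult_left integrable_mult_right) auto
    have "norm (LINT t:{a..1}|lborel. (f t - c) / t) \<le> (\<integral>t. ?w t \<partial>lborel)"
      unfolding set_lebesgue_integral_def
    proof (rule order_trans[OF integral_norm_bound], rule integral_mono)
      have bd: "norm (indicat_real {a..1} t *\<^sub>R ((f t - c) / t)) \<le> ?w t" for t
      proof (cases "t \<in> {a..1}")
        case True
        then have t: "0 < t" using a by auto
        have nn: "0 \<le> e / 2 * (1 / t)" "0 \<le> (f t + c) * (1 / \<delta>)"
          using e t c_pos f_nonneg[of t] \<delta>(1) by auto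
        have "\<bar>f t - c\<bar> * (1 / t) \<le> e / 2 * (1 / t) + (f t + c) * (1 / \<delta>)"
        proof (cases "t < \<delta>")
          case True
          then have "\<bar>f t - c\<bar> * (1 / t) \<le> e / 2 * (1 / t)"
            using near t by (intro mult_right_mono) auto
          then show ?thesis using nn by linarith
        next
          case False
          then have "\<bar>f t - c\<bar> * (1 / t) \<le> (f t + c) * (1 / \<delta>)"
            using f_nonneg[of t] c_pos \<delta>(1) by (intro mult_mono) (auto simp: field_simps)
          then show ?thesis using nn by linarith
        qed
        then show ?thesis using True t a by (simp add: abs_mult)
      next
        case False
        have "0 \<le> (f t + c * indicator {0..1} t) * (1 / \<delta>)"
          using f_nonneg[of t] c_pos \<delta>(1) by (intro mult_nonneg_nonneg add_nonneg_nonneg) auto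
        then show ?thesis using False by simp
      qed
      show "integrable lborel (\<lambda>t. norm (indicat_real {a..1} t *\<^sub>R ((f t - c) / t)))"
        by (rule Bochner_Integration.integrable_bound[OF int_w])
          (use bd in \<open>auto intro!: AE_I2 intro: order_trans[OF _ abs_ge_self]\<close>)
      show "norm (indicat_real {a..1} t *\<^sub>R ((f t - c) / t)) \<le> ?w t" for t by (rule bd)
    qed (rule int_w)
    also have "\<dots> = e / 2 * ln (real n) + K"
    proof -
      have "(\<integral>t. ?w t \<partial>lborel) = (\<integral>t. e / 2 * (indicat_real {a..1} t *\<^sub>R (1 / t)) \<partial>lborel) +
          (\<integral>t. (f t + c * indicator {0..1} t) * (1 / \<delta>) \<partial>lborel)"
        using int_1 f_integrable
        by (intro Bochner_Integration.integral_add integrable_mult_left integrable_mult_right Bochner_Integration.integrable_add) auto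
      also have "(\<integral>t. e / 2 * (indicat_real {a..1} t *\<^sub>R (1 / t)) \<partial>lborel) = e / 2 * ln (real n)"
        unfolding integral_mult_right_zero val_1 ..
      also have "(\<integral>t. (f t + c * indicator {0..1} t) * (1 / \<delta>) \<partial>lborel) = K"
        using f_integrable unfolding K_def integral_mult_left_zero by simp
      finally show ?thesis .
    qed
    finally show ?thesis using center_minus_ln[OF n] by (simp add: a_def)
  qed
  have "\<forall>\<^sub>F n in sequentially. e / 2 * ln (real n) + K \<le> e * ln (real n)"
    using e by real_asymp
  then show "\<forall>\<^sub>F n in sequentially. norm (center n - c * ln (real n)) \<le> e * norm (ln (real n))"
    using eventually_ge_at_top[of 1]
  proof eventually_elim
    case (elim n)
    then show ?case using bound[of n] by simp
  qed
qed

text \<open>Logarithmic growth of the centering suffices for the condition on \<open>w\<close> in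
  \<open>limit_law_exists\<close>, that is, for the quadratic error in the power approximation to
  vanish.\<close>

lemma center_square_lim: "(\<lambda>n. (center n)\<^sup>2 / n) \<longlonglongrightarrow> 0"
proof -
  have "(\<lambda>n. center n - c * ln (real n)) \<in> O(\<lambda>n. ln (real n))"
    using center_smallo by (rule landau_o.small_imp_big)
  moreover have "(\<lambda>n. c * ln (real n)) \<in> O(\<lambda>n. ln (real n))" by simp
  ultimately have "(\<lambda>n. (center n - c * ln (real n)) + c * ln (real n)) \<in> O(\<lambda>n. ln (real n))"
    by (rule sum_in_bigo)
  then have "center \<in> O(\<lambda>n. ln (real n))" by simp
  then have "(\<lambda>n. (center n)\<^sup>2 / n) \<in> O(\<lambda>n. (ln (real n))\<^sup>2 / n)"
    unfolding power2_eq_square by (intro landau_o.big.divide_right landau_o.big.mult eventually_sequentiallyI[of 1]) auto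
  moreover have "(\<lambda>n. (ln (real n))\<^sup>2 / n) \<in> o(\<lambda>_. 1 :: real)" by real_asymp
  ultimately have "(\<lambda>n. (center n)\<^sup>2 / n) \<in> o(\<lambda>_. 1 :: real)" by (rule landau_o.big_small_trans)
  from smalloD_tendsto[OF this] show ?thesis by simp
qed

theorem unbalanced_limit:
  assumes b: "(\<lambda>n. b n - center n) \<longlonglongrightarrow> L"
  shows "\<exists>G. unbalanced_stable_law 1 G \<and>
    weak_conv_m (\<lambda>n. distr M borel (\<lambda>\<omega>. mean_recip x n \<omega> - b n)) G"
proof -
  define h :: "real \<Rightarrow> real \<Rightarrow> complex" where
    "h t u = iexp (t * (1 / u)) - 1 - \<i> * (t * trunc_above 1 (1 / u))" for t u
  have [measurable]: "h t \<in> borel_measurable borel" for t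
    unfolding h_def by measurable
  \<comment> \<open>For u < 1 the compensator is 0, since 1 / u exceeds the truncation level, and u
    powr - 2 is at least 1. For u \<ge> 1 it is the full first-order term, so the Taylor remainder
    t^2 / (2 u^2) is left. The constant collects 2, B and B^2.\<close>
  have bound: "cmod (h t u) \<le> 2 + B + B\<^sup>2" "cmod (h t u) \<le> (2 + B + B\<^sup>2) * u powr - 2"
    if tB: "\<bar>t\<bar> \<le> B" and u: "0 < u" for t u B
  proof -
    have B: "0 \<le> B" using tB by linarith
    have "cmod (h t u) \<le> cmod (iexp (t * (1 / u)) - 1) + cmod (\<i> * (t * trunc_above 1 (1 / u)))"
      unfolding h_def by (rule norm_triangle_ineq4)
    also have "cmod (\<i> * (t * trunc_above 1 (1 / u))) = \<bar>t\<bar> * \<bar>trunc_above 1 (1 / u)\<bar>"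
      by (simp add: norm_mult)
    also have "\<dots> \<le> B * 1"
      using trunc_above_bounds[of "1 / u" 1] u tB B by (intro mult_mono) auto
    finally show "cmod (h t u) \<le> 2 + B + B\<^sup>2"
      using iexp_recip_bounds(1)[OF that] by (simp add: add_increasing2)
    show "cmod (h t u) \<le> (2 + B + B\<^sup>2) * u powr - 2"
    proof (cases "u < 1")
      case True
      then have "\<not> 1 / u \<le> 1" using u by (simp add: field_simps)
      then have "cmod (h t u) \<le> 2 * 1"
        using iexp_recip_bounds(1)[OF that] by (simp add: h_def trunc_above_def)
      also have "\<dots> \<le> (2 + B + B\<^sup>2) * u powr - 2"
        using inverse_square_le[of u 1] u True B by (intro mult_mono) auto
      finally show ?thesis .
    next
      case False
      then have "1 / u \<le> 1" using u by simp
      then have "h t u = iexp (t * (1 / u)) - (\<Sum>k\<le>1. (\<i> * (t * (1 / u))) ^ k / fact k)"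
        by (simp add: h_def trunc_above_def)
      also have "cmod \<dots> \<le> (t * (1 / u))\<^sup>2 / 2"
        using iexp_approx1[of "t * (1 / u)" 1] by (simp add: power2_eq_square fact_numeral)
      also have "\<dots> \<le> t\<^sup>2 * u powr - 2"
        using u by (simp add: powr_minus_divide power_divide divide_simps)
      also have "\<dots> \<le> (2 + B + B\<^sup>2) * u powr - 2"
      proof (intro mult_right_mono)
        have "t\<^sup>2 \<le> B\<^sup>2" using tB B by (simp add: abs_le_square_iff[symmetric])
        then show "t\<^sup>2 \<le> 2 + B + B\<^sup>2" using B by simp
      qed simp
      finally show ?thesis .
    qed
  qed
  have rel: "of_nat n * (char recip_law (1 / scale n * t) - 1) - \<i> * (t * center n) =
      real n *\<^sub>R expectation (\<lambda>\<omega>. h t (scale n * x 0 \<omega>))" for n t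
  proof (cases "n = 0")
    case True
    \<comment> \<open>At n = 0 the identity requires the centering to vanish: a nonnegative
      reciprocal truncated at level 0 is 0.\<close>
    have "center 0 = expectation (\<lambda>\<omega>. 0)"
      unfolding center_def
    proof (rule Bochner_Integration.integral_cong[OF refl])
      fix \<omega> assume "\<omega> \<in> space M"
      then have "0 \<le> 1 / x 0 \<omega>" using x_nonneg[of \<omega> 0] by simp
      then show "trunc_above (real 0) (1 / x 0 \<omega>) = 0" by (auto simp: trunc_above_def)
    qed
    then show ?thesis using True by simp
  next
    case False
    then have n: "0 < n" by simp
    have tr: "integrable M (\<lambda>\<omega>. \<i> * (t * trunc_above 1 (1 / (scale n * x 0 \<omega>))))"
      using integrable_trunc[of "scale n" 1] n
      by (intro integrable_mult_right integrable_of_real) (auto simp: scale_flat)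
    have ie: "integrable M (\<lambda>\<omega>. iexp (1 / scale n * t * (1 / x 0 \<omega>)) - 1)"
      by (intro Bochner_Integration.integrable_diff integrable_iexp_recip) simp
    have "expectation (\<lambda>\<omega>. h t (scale n * x 0 \<omega>)) =
        expectation (\<lambda>\<omega>. (iexp (1 / scale n * t * (1 / x 0 \<omega>)) - 1) - \<i> * (t * trunc_above 1 (1 / (scale n * x 0 \<omega>))))"
      by (simp add: h_def)
    also have "\<dots> = expectation (\<lambda>\<omega>. iexp (1 / scale n * t * (1 / x 0 \<omega>)) - 1) -
        expectation (\<lambda>\<omega>. \<i> * (t * trunc_above 1 (1 / (scale n * x 0 \<omega>))))"
      by (rule Bochner_Integration.integral_diff[OF ie tr])
    also have "expectation (\<lambda>\<omega>. iexp (1 / scale n * t * (1 / x 0 \<omega>)) - 1) = char recip_law (1 / scale n * t) - 1"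
      unfolding char_recip_law
      by (subst Bochner_Integration.integral_diff[OF integrable_iexp_recip]) (auto simp: prob_space)
    also have "expectation (\<lambda>\<omega>. \<i> * (t * trunc_above 1 (1 / (scale n * x 0 \<omega>)))) =
        \<i> * (t * expectation (\<lambda>\<omega>. trunc_above 1 (1 / (scale n * x 0 \<omega>))))"
      by (simp add: integral_complex_of_real)
    also have "expectation (\<lambda>\<omega>. trunc_above 1 (1 / (scale n * x 0 \<omega>))) = center n / n"
      unfolding trunc_recip[OF n, symmetric] by (simp add: center_def)
    finally have E: "expectation (\<lambda>\<omega>. h t (scale n * x 0 \<omega>)) =
        char recip_law (1 / scale n * t) - 1 - \<i> * (t * (center n / n))" by simp
    show ?thesis unfolding E using n by (simp add: scaleR_conv_of_real right_diff_distrib)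
  qed
  have "\<exists>G. real_distribution G \<and>
    weak_conv_m (\<lambda>n. distr M borel (\<lambda>\<omega>. 1 / scale n * (\<Sum>i<n. 1 / x i \<omega>) - b n)) G \<and>
    char G = (\<lambda>t. exp (c *\<^sub>R (LINT u:{0<..}|lborel. u powr 0 *\<^sub>R h t u) - \<i> * (t * L)))"
  proof (rule limit_law_exists[where k = 2 and A = "\<lambda>B. 2 + B + B\<^sup>2" and w = center])
    show "isCont (\<lambda>t. h t u) 0" for u
      unfolding h_def by (intro continuous_intros)
  qed (use bound rel b center_square_lim in auto)
  then obtain G where G: "real_distribution G"
    "weak_conv_m (\<lambda>n. distr M borel (\<lambda>\<omega>. 1 / scale n * (\<Sum>i<n. 1 / x i \<omega>) - b n)) G"
    by blast
  interpret T: cauchy_tailed_iid M "\<lambda>i \<omega>. 1 / x i \<omega>" c L b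
  proof
    fix y :: real assume y: "0 < y"
    show "(\<lambda>n. real n * prob {\<omega> \<in> space M. real n * y < 1 / x 0 \<omega>}) \<longlonglongrightarrow> c / y"
      by (rule tail_limit[OF y])
    show "(\<lambda>n. real n * expectation (\<lambda>\<omega>. (trunc_above (real n * y) (1 / x 0 \<omega>) / real n)\<^sup>2)) \<longlonglongrightarrow> c * y"
      by (rule trunc_second_moment_limit[OF y])
    show "(\<lambda>n. real n * expectation (\<lambda>\<omega>. trunc_above (real n * y) (1 / x 0 \<omega>) / real n) - b n) \<longlonglongrightarrow> c * ln y - L"
      using tendsto_diff[OF trunc_mean_limit[OF y] b] by simp
  qed (use iid_recip c_pos x_nonneg in auto)
  have conv: "weak_conv_m (\<lambda>n. distr M borel (T.S n)) G"
    using G(2) unfolding T.S_def[abs_def] scale_flat .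
  note left = T.left_tail[OF G(1) conv] and right = T.right_tail[OF G(1) conv]
  interpret G: real_distribution G by (rule G(1))
  have nondeg: "G \<noteq> return borel a" for a
  proof
    assume eq: "G = return borel a"
    \<comment> \<open>A point mass has no right tail beyond its atom, which contradicts the tail
      constant c > 0.\<close>
    have "\<forall>\<^sub>F t in at_top. t * (1 - cdf G t) = 0"
      using eventually_ge_at_top[of a]
      by eventually_elim (simp add: eq cdf_def measure_return)
    from tendsto_cong[THEN iffD1, OF this right] have "((\<lambda>_. 0) \<longlongrightarrow> c) (at_top :: real filter)" .
    then show False using c_pos by (simp add: tendsto_const_iff)
  qed
  have "stable_law 1 G"
  proof (rule stable_law_of_limit[OF iid_recip, where b = b])
    have "real n powr (- 1 / 1) = 1 / scale n" for n
      by (cases "n = 0") (simp_all add: scale_flat powr_minus_divide)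
    then show "weak_conv_m (\<lambda>n. distr M borel (\<lambda>\<omega>. real n powr (- 1 / 1) * (\<Sum>i<n. 1 / x i \<omega>) - b n)) G"
      using G(2) by (simp only:)
  qed (use G(1) nondeg in auto)
  moreover have "((\<lambda>t. t powr 1 * (1 - cdf G t)) \<longlongrightarrow> c * 1) at_top"
    by (rule Lim_transform_eventually[rotated, OF eventually_mono[OF eventually_gt_at_top[of 0]]])
      (use right in auto)
  moreover have "((\<lambda>t. t powr 1 * cdf G (- t)) \<longlongrightarrow> c * 0) at_top"
    by (rule Lim_transform_eventually[rotated, OF eventually_mono[OF eventually_gt_at_top[of 0]]])
      (use left in auto)
  ultimately have "unbalanced_stable_law 1 G"
    unfolding unbalanced_stable_law_def using c_pos
    by (intro conjI exI[of _ c] exI[of _ "1 :: real"] exI[of _ "0 :: real"]) auto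
  then show ?thesis
    using G(2) unfolding mean_recip_def scale_flat by blast
qed

end

text \<open>For \<beta> = 0 the asymptotics of \<open>f\<close> determine the centering only up to
  o(ln n). Centering by exactly c ln n is therefore tied to convergence of the improper integral,
  while the second conclusion holds for every such \<open>f\<close> with a correction
  \<open>r\<close>.\<close>

theorem theoremD:
  fixes M :: "'a measure" and x :: "nat \<Rightarrow> 'a \<Rightarrow> real"
    and f :: "real \<Rightarrow> real" and c \<beta> :: real
  assumes iid: "iid M x"
    and range: "\<And>i \<omega>. \<omega> \<in> space M \<Longrightarrow> x i \<omega> \<in> {0..1}"
    and f_meas: "f \<in> borel_measurable borel"
    and f_nonneg: "\<And>t. 0 \<le> f t"
    and density: "\<And>i. distributed M lborel (x i) (\<lambda>t. ennreal (f t))"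
    and c: "0 < c"
    and \<beta>: "-1 < \<beta>"
    and asymp: "((\<lambda>t. f t / (c * t powr \<beta>)) \<longlongrightarrow> 1) (at_right 0)"
  shows
    "(\<beta> = 0 \<longrightarrow>
        (log_centering_condition f c \<longrightarrow>
          (\<exists>G. unbalanced_stable_law 1 G \<and>
             weak_conv_m (\<lambda>n. distr M borel (\<lambda>\<omega>. mean_recip x n \<omega> - c * ln (real n))) G)) \<and>
        (\<exists>G r. unbalanced_stable_law 1 G \<and> r \<in> o(\<lambda>n. ln (real n)) \<and>
             weak_conv_m
               (\<lambda>n. distr M borel (\<lambda>\<omega>. mean_recip x n \<omega> - (c * ln (real n) + r n))) G)) \<and>
     (\<beta> > 0 \<longrightarrow>
        integrable M (\<lambda>\<omega>. 1 / x 0 \<omega>) \<and>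
        weak_conv_m (\<lambda>n. distr M borel (mean_recip x n))
          (return borel (\<integral>\<omega>. 1 / x 0 \<omega> \<partial>M))) \<and>
     (\<beta> < 0 \<longrightarrow>
        (\<exists>G. stable_law (1 + \<beta>) G \<and>
           weak_conv_m
             (\<lambda>n. distr M borel (\<lambda>\<omega>. real n powr (1 - 1 / (1 + \<beta>)) * mean_recip x n \<omega>)) G))"
proof -
  have sample: "recip_sample M f c \<beta> x"
    by (intro recip_sample.intro power_density.intro recip_sample_axioms.intro
        iidD(1)[OF iid] distributed_integrable[OF iidD(1)[OF iid] density[of 0]] assms)
  have flat: "recip_sample_flat M f c x" if "\<beta> = 0"
    using sample that by (simp add: recip_sample_flat_def)
  show ?thesis
  proof (intro conjI impI)
    assume "\<beta> = 0" "log_centering_condition f c"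
    interpret recip_sample_flat M f c x by (rule flat) fact
    obtain L where L: "((\<lambda>e. LINT t:{e..1}|lborel. (f t - c) / t) \<longlongrightarrow> L) (at_right 0)"
      using \<open>log_centering_condition f c\<close> by (auto simp: log_centering_condition_def)
    have "filterlim (\<lambda>n. 1 / real n) (at_right 0) sequentially" by real_asymp
    from filterlim_compose[OF L this]
    have "(\<lambda>n. LINT t:{1 / real n..1}|lborel. (f t - c) / t) \<longlonglongrightarrow> L" .
    then have "(\<lambda>n. center n - c * ln (real n)) \<longlonglongrightarrow> L"
      by (rule Lim_transform_eventually) (auto intro!: eventually_sequentiallyI[of 1] simp: center_minus_ln)
    \<comment> \<open>The centering c ln n differs from the exact one by a convergent sequence, so
      it only shifts the limit law.\<close>
    from tendsto_minus[OF this] have "(\<lambda>n. c * ln (real n) - center n) \<longlonglongrightarrow> - L" by simp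
    then show "\<exists>G. unbalanced_stable_law 1 G \<and>
        weak_conv_m (\<lambda>n. distr M borel (\<lambda>\<omega>. mean_recip x n \<omega> - c * ln (real n))) G"
      by (rule unbalanced_limit)
  next
    assume "\<beta> = 0"
    interpret recip_sample_flat M f c x by (rule flat) fact
    \<comment> \<open>The correction is r n = \<open>center n\<close> - c ln n, so the total
      centering is the exact one and the offset is 0.\<close>
    have "(\<lambda>n. (c * ln (real n) + (center n - c * ln (real n))) - center n) \<longlonglongrightarrow> 0" by simp
    from unbalanced_limit[OF this] center_smallo
    show "\<exists>G r. unbalanced_stable_law 1 G \<and> r \<in> o(\<lambda>n. ln (real n)) \<and>
        weak_conv_m (\<lambda>n. distr M borel (\<lambda>\<omega>. mean_recip x n \<omega> - (c * ln (real n) + r n))) G"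
      by blast
  qed (use recip_sample.weak_law_of_pos_exponent[OF sample] recip_sample.stable_limit_of_neg_exponent[OF sample] in auto)
qed

end
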